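(* Let $\gamma\ge 2$ be real and $\mathbb{H}_{\gamma}=\{(z_1,z_2)\in\mathbb{C}^2:|z_1|^{\gamma}<|z_2|<1\}$. The Bergman kernel $\mathbb{B}_\gamma(z,w)$ of $\mathbb{H}_\gamma$ has zeroes inside $\mathbb{H}_\gamma\times\mathbb{H}_\gamma$, i.e. there exists $(z,w)\in\mathbb{H}_\gamma\times\mathbb{H}_\gamma$ with $\mathbb{B}_\gamma(z,w)=0$.
   Context: The Bergman kernel of a domain $\Omega$ is the reproducing kernel of the space $A^2(\Omega)$ of holomorphic functions on $\Omega$ square integrable with respect to Lebesgue measure. *)

theory Defs
  imports "HOL-Analysis.Analysis"
begin

text \<open>Points of C^2 are pairs of complex numbers; the type complex \<times> complex is
  a Euclidean space (= R^4), so lebesgue is Lebesgue measure on C^2.\<close>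

text \<open>Holomorphy in two complex variables: open domain, and at every point f is
  (Frechet) differentiable with a complex-linear differential.\<close>
definition holomorphic2_on :: "(complex \<times> complex \<Rightarrow> complex) \<Rightarrow> (complex \<times> complex) set \<Rightarrow> bool" where
  "holomorphic2_on f \<Omega> \<longleftrightarrow>
     (\<forall>z\<in>\<Omega>. \<exists>a b. (f has_derivative (\<lambda>h. a * fst h + b * snd h)) (at z))"

definition bergman_space :: "(complex \<times> complex) set \<Rightarrow> (complex \<times> complex \<Rightarrow> complex) set" where
  "bergman_space \<Omega> = {f. holomorphic2_on f \<Omega> \<and>
      set_integrable lebesgue \<Omega> (\<lambda>z. (norm (f z))\<^sup>2)}"

definition is_bergman_kernel ::
  "(complex \<times> complex) set \<Rightarrow> (complex \<times> complex \<Rightarrow> complex \<times> complex \<Rightarrow> complex) \<Rightarrow> bool" where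
  "is_bergman_kernel \<Omega> K \<longleftrightarrow>
     (\<forall>w\<in>\<Omega>. (\<lambda>z. K z w) \<in> bergman_space \<Omega>) \<and>
     (\<forall>f\<in>bergman_space \<Omega>. \<forall>w\<in>\<Omega>.
        f w = set_lebesgue_integral lebesgue \<Omega> (\<lambda>z. f z * cnj (K z w)))"

definition H_gamma :: "real \<Rightarrow> (complex \<times> complex) set" where
  "H_gamma \<gamma> = {z. norm (fst z) powr \<gamma> < norm (snd z) \<and> norm (snd z) < 1}"

end

theory Submission
  imports Defs "HOL-Probability.Probability_Measure" "HOL-Real_Asymp.Real_Asymp"
    "HOL-Complex_Analysis.Complex_Analysis"
begin

text \<open>
  The monomials $z_1^m z_2^n$ that are square integrable are orthogonal, and they determine the kernel:
  with $s = z_1 \bar w_1$ and $t = z_2 \bar w_2$,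
  $\pi^2 K(z, w) = \sum (m+1)(n+1+(m+1)/\gamma) s^m t^n$ over $m \geq 0$, $n+1+(m+1)/\gamma > 0$.
  Averaging over the torus action replaces polar coordinates, and uniqueness of Fourier
  coefficients on a torus orbit replaces the convergence of Laurent series in two variables.

  For $\gamma > 2$ take $w_1 = 0$: only $m = 0$ survives, and the sum is a multiple of
  $1/(1-t)^2 + (1/\gamma-1)/(1-t)$, which vanishes at $t = -1/(\gamma-1)$. For $\gamma = 2$ this zero lies on
  the boundary. There put $t = \tau^2$ and $s = \sigma \tau$; with $A(x) = 1/(1-x)^2$ the kernel is a
  multiple of $A(\sigma)A(\tau) + A(-\sigma)A(-\tau)$, which vanishes at
  $\sigma = \tau = i \tan(\pi/8) = i(\sqrt 2 - 1)$.
\<close>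

text \<open>Only the defining property of the kernel is available. So \<open>K z w\<close> is
  treated, for fixed w, as a square integrable function of z. Testing the reproducing formula on a
  square integrable monomial gives the corresponding Laurent coefficient of this function, and
  square integrability kills all other coefficients. The expansion is made along orbits with z_1
  nonzero, where negative powers are harmless; this is why the coordinate set to 0 for gamma > 2
  belongs to w and not to z. In that case the exponent n starts at -1, because 0 < 1/gamma < 1, and
  the bracket vanishes exactly when 1/(1-t) = 1 - 1/gamma. For gamma = 2 the weight is
  (m+1)(2n+m+3)/2. With i = m and j = 2n+m+2 it is (i+1)(j+1)/2, so the double sum would factor if
  all pairs i, j >= 0 occurred. Only those with i+j even occur, and adding the product at (-sigma,
  -tau) selects them. With sigma = tau the equation reads ((1+tau)/(1-tau))^4 = -1; putting tau = i
  tan(theta) turns the left side into exp(8 i theta), whence theta = pi/8.\<close>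

subsection \<open>Measure-theoretic preliminaries\<close>

text \<open>With $B$ the unit ball, both $\lambda(A) \lambda(B)$ and $M(A) \lambda(B)$ are equal to
  $\int \int 1_A(x+y) 1_B(y) dx dM(y)$, by the two orders of integration.\<close>
lemma translation_invariant_eq_lborel:
  fixes M :: "'a::euclidean_space measure"
  assumes sets_M[simp, measurable_cong]: "sets M = sets borel" and "sigma_finite_measure M"
    and transl: "\<And>a. distr M borel ((+) a) = M"
    and ball: "emeasure M (ball 0 1) = emeasure lborel (ball (0::'a) 1)"
  shows "M = lborel"
proof (rule measure_eqI)
  fix A assume "A \<in> sets M"
  then have [measurable]: "A \<in> sets borel" by simp
  interpret M: sigma_finite_measure M by fact
  interpret P: pair_sigma_finite lborel M ..
  define V where "V = emeasure lborel (ball (0::'a) 1)"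
  have V: "V \<noteq> 0" "V \<noteq> \<infinity>"
    using content_ball_gt_0_iff[of "0::'a" 1] emeasure_lborel_ball_finite[of "0::'a" 1]
    by (auto simp: V_def measure_def less_top)
  have Vb: "emeasure lborel (ball y 1) = V" for y :: 'a
    by (simp add: V_def emeasure_ball)
  define g :: "'a \<Rightarrow> ennreal" where "g = indicator (ball 0 1)"
  have [measurable]: "g \<in> borel_measurable borel"
    unfolding g_def by (intro borel_measurable_indicator borel_open open_ball)
  have tL: "(\<integral>\<^sup>+x. h (x + y) \<partial>lborel) = (\<integral>\<^sup>+x. h x \<partial>lborel)"
    if [measurable]: "h \<in> borel_measurable borel" for h :: "'a \<Rightarrow> ennreal" and y
    by (subst (2) lborel_distr_plus[of y, symmetric]) (simp add: nn_integral_distr add.commute)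
  have tM: "(\<integral>\<^sup>+x. h (y + x) \<partial>M) = (\<integral>\<^sup>+x. h x \<partial>M)"
    if [measurable]: "h \<in> borel_measurable borel" for h :: "'a \<Rightarrow> ennreal" and y
    by (subst (2) transl[of y, symmetric]) (simp add: nn_integral_distr)
  have "emeasure lborel A * V = (\<integral>\<^sup>+y. emeasure lborel A * g y \<partial>M)"
    using ball by (simp add: nn_integral_cmult_indicator V_def g_def)
  also have "\<dots> = (\<integral>\<^sup>+y. (\<integral>\<^sup>+x. indicator A (x + y) * g y \<partial>lborel) \<partial>M)"
    by (intro nn_integral_cong) (simp add: nn_integral_multc tL)
  also have "\<dots> = (\<integral>\<^sup>+x. (\<integral>\<^sup>+y. indicator A (x + y) * g y \<partial>M) \<partial>lborel)"
    by (rule P.Fubini') measurable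
  also have "\<dots> = (\<integral>\<^sup>+x. (\<integral>\<^sup>+y. indicator A y * g (y - x) \<partial>M) \<partial>lborel)"
  proof (rule nn_integral_cong)
    fix x :: 'a
    show "(\<integral>\<^sup>+y. indicator A (x + y) * g y \<partial>M) = (\<integral>\<^sup>+y. indicator A y * g (y - x) \<partial>M)"
      using tM[of "\<lambda>y. indicator A y * g (y - x)" x] by simp
  qed
  also have "\<dots> = (\<integral>\<^sup>+y. (\<integral>\<^sup>+x. indicator A y * g (y - x) \<partial>lborel) \<partial>M)"
    by (rule P.Fubini'[symmetric]) measurable
  also have "\<dots> = (\<integral>\<^sup>+y. indicator A y * V \<partial>M)"
  proof (intro nn_integral_cong)
    fix y :: 'a
    have "g (y - x) = (indicator (ball y 1) x :: ennreal)" for x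
      by (simp add: g_def indicator_def dist_norm norm_minus_commute)
    then show "(\<integral>\<^sup>+x. indicator A y * g (y - x) \<partial>lborel) = indicator A y * V"
      by (simp add: nn_integral_cmult_indicator Vb)
  qed
  also have "\<dots> = emeasure M A * V"
    by (simp add: nn_integral_multc)
  finally show "emeasure M A = emeasure lborel A"
    using V ennreal_mult_cancel_left[of V] by (auto simp: mult.commute)
qed simp

text \<open>The image measure is again translation invariant, because translating by
  \<open>a\<close> after T is the same as translating by the preimage \<open>S a\<close> before T.
  The unit ball keeps its volume since T preserves norms, so the uniqueness lemma applies.\<close>

lemma lborel_distr_orthogonal:
  fixes T :: "'a::euclidean_space \<Rightarrow> 'a"
  assumes T: "orthogonal_transformation T"
  shows "distr lborel borel T = lborel"
proof (rule translation_invariant_eq_lborel)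
  have lin: "linear T" using T by (simp add: orthogonal_transformation_def)
  have nrm: "norm (T x) = norm x" for x using T by (simp add: orthogonal_transformation)
  have [measurable]: "T \<in> borel_measurable borel"
    using lin by (intro borel_measurable_continuous_onI linear_continuous_on linear_conv_bounded_linear[THEN iffD1])
  obtain S where S: "\<And>x. T (S x) = x" "\<And>x. S (T x) = x"
    using orthogonal_transformation_bij[OF T] by (metis bij_inv_eq_iff)
  show "sets (distr lborel borel T) = sets borel" by simp
  have pre: "T -` ball 0 r = ball 0 r" for r by (auto simp: nrm)
  show "emeasure (distr lborel borel T) (ball 0 1) = emeasure lborel (ball (0::'a) 1)"
    by (simp add: emeasure_distr pre)
  show "sigma_finite_measure (distr lborel borel T)"
  proof
    show "\<exists>A. countable A \<and> A \<subseteq> sets (distr lborel borel T) \<and> \<Union> A = space (distr lborel borel T) \<and>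
        (\<forall>a\<in>A. emeasure (distr lborel borel T) a \<noteq> \<infinity>)"
    proof (intro exI[of _ "range (\<lambda>n::nat. ball 0 (real n))"] conjI ballI)
      show "\<Union> (range (\<lambda>n::nat. ball (0::'a) (real n))) = space (distr lborel borel T)"
        using reals_Archimedean2 by auto
      fix a assume "a \<in> range (\<lambda>n::nat. ball (0::'a) (real n))"
      then show "emeasure (distr lborel borel T) a \<noteq> \<infinity>"
        using emeasure_lborel_ball_finite[of "0::'a"] by (auto simp: emeasure_distr pre less_top)
    qed auto
  qed
  fix a
  have "distr (distr lborel borel T) borel ((+) a) = distr (distr lborel borel ((+) (S a))) borel T"
    by (simp add: distr_distr o_def linear_add[OF lin] S)
  also have "\<dots> = distr lborel borel T" by (simp add: lborel_distr_plus)
  finally show "distr (distr lborel borel T) borel ((+) a) = distr lborel borel T" .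
qed

text \<open>Under the squared modulus, area is pushed forward to pi times length on the half line,
  since the disc of squared radius a has area pi a. This is the only trace of polar coordinates in
  the computation of norms.\<close>

lemma nn_integral_norm_power2_complex:
  assumes [measurable]: "h \<in> borel_measurable borel"
  shows "(\<integral>\<^sup>+z. h ((norm (z::complex))\<^sup>2) \<partial>lborel) = ennreal pi * (\<integral>\<^sup>+x. h x * indicator {0..} x \<partial>lborel)"
proof -
  define M where "M = distr lborel borel (\<lambda>z::complex. (norm z)\<^sup>2)"
  define N where "N = density lborel (\<lambda>x::real. ennreal pi * indicator {0..} x)"
  have eqM: "emeasure M {..a} = ennreal (pi * max 0 a)" for a
  proof -
    have "(\<lambda>z::complex. (norm z)\<^sup>2) -` {..a} = (if a < 0 then {} else cball 0 (sqrt a))"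
      by (auto simp: real_le_rsqrt) (metis order_trans not_le zero_le_power2,
         metis abs_norm_cancel real_sqrt_abs real_sqrt_le_iff)
    then show ?thesis
      by (auto simp: M_def emeasure_distr emeasure_cball unit_ball_vol_2 max_def)
  qed
  have eqN: "emeasure N {..a} = ennreal (pi * max 0 a)" for a
  proof -
    have "emeasure N {..a} = (\<integral>\<^sup>+x. ennreal pi * indicator {0..a} x \<partial>lborel)"
      unfolding N_def by (subst emeasure_density)
         (auto intro!: nn_integral_cong simp: indicator_def)
    also have "\<dots> = ennreal (pi * max 0 a)"
      by (cases "a \<ge> 0") (simp_all add: nn_integral_cmult_indicator ennreal_mult max_def)
    finally show ?thesis .
  qed
  have "M = N"
  proof (rule measure_eqI_generator_eq[where E="range atMost" and \<Omega>=UNIV and A="\<lambda>n. {..real n}"])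
    show "Int_stable (range (atMost :: real \<Rightarrow> _))"
      by (auto simp: Int_stable_def)
    show "sets M = sigma_sets UNIV (range atMost)" "sets N = sigma_sets UNIV (range atMost)"
      by (simp_all add: M_def N_def borel_eq_atMost)
    show "(\<Union>i. {..real i}) = UNIV" using real_arch_simple by auto
  qed (auto simp: eqM eqN)
  have "(\<integral>\<^sup>+z. h ((norm (z::complex))\<^sup>2) \<partial>lborel) = integral\<^sup>N M h"
    by (simp add: M_def nn_integral_distr)
  also have "\<dots> = (\<integral>\<^sup>+x. ennreal pi * (h x * indicator {0..} x) \<partial>lborel)"
    unfolding \<open>M = N\<close> N_def by (subst nn_integral_density) (auto simp: mult_ac)
  finally show ?thesis by (simp add: nn_integral_cmult)
qed

lemma nn_integral_powr_less:
  fixes a A :: real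
  assumes "0 < A" "A \<le> 1"
  shows "(\<integral>\<^sup>+x. ennreal (x powr a) * indicator {0<..<A} x \<partial>lborel)
     = (if a > -1 then ennreal (A powr (a + 1) / (a + 1)) else \<infinity>)"
proof -
  have fin: "(\<integral>\<^sup>+x. ennreal (x powr b) * indicator {0<..<A} x \<partial>lborel) = ennreal (A powr (b + 1) / (b + 1))"
    if "b > -1" for b
  proof -
    have "(\<integral>\<^sup>+x. ennreal (x powr b) * indicator {0<..<A} x \<partial>lborel)
       = (\<integral>\<^sup>+x. ennreal (indicator {0..A} x * (x powr b)) \<partial>lborel)"
      by (intro nn_integral_cong_AE)
        (use AE_lborel_singleton[of A] AE_lborel_singleton[of 0] in \<open>auto simp: indicator_def\<close>)
    also have "\<dots> = ennreal (A powr (b + 1) / (b + 1))"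
      using has_integral_powr_from_0[OF that, of A] assms
      by (intro nn_integral_has_integral_lebesgue) auto
    finally show ?thesis .
  qed
  show ?thesis
  proof (cases "a > -1")
    case True
    then show ?thesis using fin by simp
  next
    case False
    let ?I = "\<integral>\<^sup>+x. ennreal (x powr a) * indicator {0<..<A} x \<partial>lborel"
    \<comment> \<open>Divergence by comparison: since A <= 1 and a <= -1, the power x^a dominates
      x^(e-1) on the interval for every e > 0. The integral of the latter is A^e / e, which is
      unbounded as e tends to 0.\<close>
    have ge: "ennreal (A powr e / e) \<le> ?I" if "e > 0" for e
    proof -
      have "x powr (e - 1) \<le> x powr a" if "0 < x" "x < A" for x
        using that assms False \<open>e > 0\<close> by (intro powr_mono') auto
      then have "(\<integral>\<^sup>+x. ennreal (x powr (e-1)) * indicator {0<..<A} x \<partial>lborel) \<le> ?I"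
        by (intro nn_integral_mono) (auto simp: indicator_def intro!: ennreal_leI)
      then show ?thesis using fin[of "e - 1"] that by simp
    qed
    have "?I = \<infinity>"
    proof (rule ccontr)
      assume "?I \<noteq> \<infinity>"
      then obtain r where r: "r \<ge> 0" "?I = ennreal r" by (metis ennreal_cases infinity_ennreal_def)
      have le: "A powr e / e \<le> r" if "e > 0" for e
        using ge[OF that] r by simp
      have "filterlim (\<lambda>n. A powr (1 / real (Suc n)) * real (Suc n)) at_top sequentially"
        using assms by real_asymp
      then have "eventually (\<lambda>n. A powr (1 / real (Suc n)) * real (Suc n) > r) sequentially"
        by (simp add: filterlim_at_top_dense)
      then obtain n where "A powr (1 / real (Suc n)) * real (Suc n) > r"
        by (auto simp: eventually_sequentially)
      with le[of "1 / real (Suc n)"] show False by simp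
    qed
    with False show ?thesis by simp
  qed
qed

subsection \<open>Averages over the unit circle\<close>

definition unit_loop :: "real \<Rightarrow> complex" where
  "unit_loop t = exp (2 * of_real pi * \<i> * of_real t)"

lemma norm_unit_loop [simp]: "norm (unit_loop t) = 1"
  by (simp add: unit_loop_def norm_exp_eq_Re)

lemma continuous_on_unit_loop [continuous_intros]: "continuous_on S unit_loop"
  unfolding unit_loop_def by (intro continuous_intros)

lemma measurable_unit_loop [measurable]: "unit_loop \<in> borel_measurable borel"
  by (intro borel_measurable_continuous_onI continuous_on_unit_loop)

lemma range_unit_loop: "norm u = 1 \<Longrightarrow> \<exists>t\<in>{0..1}. u = unit_loop t"
proof -
  assume u: "norm u = 1"
  obtain t where t: "0 \<le> t" "t < 2 * pi" "u = exp (\<i> * of_real t)"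
    using complex_norm_eq_1_exp[of u] u Arg2pi_ge_0[of u] Arg2pi_lt_2pi[of u] Arg2pi_eq[of u]
    by (metis norm_of_real of_real_1 abs_1 mult_1)
  show ?thesis
    by (rule bexI[of _ "t / (2 * pi)"]) (use t in \<open>auto simp: unit_loop_def field_simps\<close>)
qed

text \<open>Normalized arc length, realised as a Borel measure on the whole plane. Lying on the
  circle then becomes an almost-everywhere property, and products of such measures live on the Borel
  sets of C^2.\<close>

definition circle_measure :: "complex measure" where
  "circle_measure = distr (restrict_space lborel {0..1}) borel unit_loop"

lemma sets_circle_measure [simp, measurable_cong]: "sets circle_measure = sets borel"
  by (simp add: circle_measure_def)

lemma space_circle_measure [simp]: "space circle_measure = UNIV"
  by (simp add: circle_measure_def)

lemma measurable_unit_loop_restrict [measurable]: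
  "unit_loop \<in> borel_measurable (restrict_space lborel {0..1})"
  by (rule measurable_restrict_space1) simp

interpretation circle: prob_space circle_measure
proof -
  have "prob_space (restrict_space lborel {0..1::real})"
    by (rule prob_space_restrict_space) auto
  then show "prob_space circle_measure"
    unfolding circle_measure_def by (rule prob_space.prob_space_distr) simp
qed

lemma AE_circle_iff:
  assumes [measurable]: "Measurable.pred borel P"
  shows "(AE u in circle_measure. P u) \<longleftrightarrow> (AE t in lborel. t \<in> {0..1} \<longrightarrow> P (unit_loop t))"
  unfolding circle_measure_def
  by (subst AE_distr_iff) (simp_all add: AE_restrict_space_iff)

lemma AE_circle_norm: "AE u in circle_measure. norm u = 1"
  by (subst AE_circle_iff) auto

text \<open>Pulled back to the parameter interval, the zero set is closed and has full measure in
  the open interval, hence contains it; taking the closure adds the endpoints.\<close>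

lemma AE_circle_eq_0D:
  fixes f :: "complex \<Rightarrow> complex"
  assumes [measurable]: "f \<in> borel_measurable borel" and cont: "continuous_on (sphere 0 1) f"
    and ae: "AE u in circle_measure. f u = 0" and u: "norm u = 1"
  shows "f u = 0"
proof -
  have c: "continuous_on UNIV (f \<circ> unit_loop)"
    by (rule continuous_on_compose[OF continuous_on_unit_loop])
       (rule continuous_on_subset[OF cont], auto)
  define C where "C = {t. (f \<circ> unit_loop) t = 0}"
  have C: "closed C"
    unfolding C_def by (rule closed_Collect_eq[OF c]) simp
  have "AE t in lborel. t \<in> {0..1} \<longrightarrow> f (unit_loop t) = 0"
    using ae by (subst (asm) AE_circle_iff) auto
  then have "AE t in lebesgue. t \<in> {0..1} \<longrightarrow> f (unit_loop t) = 0"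
    by (rule AE_completion)
  then have "AE t \<in> {0<..<1::real} in lebesgue. t \<in> C"
    by eventually_elim (auto simp: C_def)
  then have "x \<in> C" if "x \<in> {0<..<1}" for x
    using that by (intro mem_closed_if_AE_lebesgue_open[OF open_greaterThanLessThan C])
  then have "closure {0<..<1} \<subseteq> C"
    using C by (intro closure_minimal) auto
  moreover obtain t where "t \<in> {0..1}" "u = unit_loop t"
    using range_unit_loop[OF u] by blast
  ultimately show ?thesis
    by (auto simp: C_def closure_greaterThanLessThan)
qed

lemma integral_circle_measure:
  fixes f :: "complex \<Rightarrow> 'b::{banach, second_countable_topology}"
  assumes [measurable]: "f \<in> borel_measurable borel"
  shows "(\<integral>u. f u \<partial>circle_measure) = (LINT t:{0..1}|lborel. f (unit_loop t))"
  unfolding circle_measure_def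
  by (subst integral_distr) (simp_all add: integral_restrict_space set_lebesgue_integral_def)

text \<open>The mean of g over the circle through c is the contour integral of g(z)/z divided by 2
  pi i. Circles in an annulus avoiding 0 are homotopic, so Cauchy's theorem makes the mean
  independent of the radius. The arguments of a and b may differ.\<close>

lemma integral_circle_measure_annulus:
  fixes g :: "complex \<Rightarrow> complex"
  assumes [measurable]: "g \<in> borel_measurable borel"
    and hol: "g holomorphic_on {z. r < norm z \<and> norm z < R}"
    and r: "0 \<le> r" and a: "r < norm a" "norm a < R" and b: "r < norm b" "norm b < R"
  shows "(\<integral>u. g (a * u) \<partial>circle_measure) = (\<integral>u. g (b * u) \<partial>circle_measure)"
proof -
  define S where "S = {z::complex. r < norm z \<and> norm z < R}"
  have oS: "open S" unfolding S_def
    by (intro open_Collect_conj open_Collect_less continuous_intros)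
  define p where "p c t = c * unit_loop t" for c t
  have der: "(p c has_vector_derivative 2 * of_real pi * \<i> * p c t) (at t within T)" for c t T
    unfolding p_def unit_loop_def
    by (rule has_vector_derivative_real_field[where f="\<lambda>z. c * exp (2 * of_real pi * \<i> * z)"])
       (auto intro!: derivative_eq_intros)
  have vp: "valid_path (p c)" for c
    unfolding valid_path_def
  proof (rule C1_differentiable_imp_piecewise)
    show "p c C1_differentiable_on {0..1}"
      unfolding C1_differentiable_on_def
      by (rule exI[of _ "\<lambda>t. 2 * of_real pi * \<i> * p c t"])
         (use der in \<open>auto simp: p_def[abs_def] intro!: continuous_intros\<close>)
  qed
  have avg: "contour_integral (p c) (\<lambda>z. g z / z) = 2 * of_real pi * \<i> * (\<integral>u. g (c * u) \<partial>circle_measure)"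
    if c: "r < norm c" "norm c < R" for c
  proof -
    have c0: "c \<noteq> 0" using c r by auto
    have "continuous_on {0..1} (\<lambda>t. g (c * unit_loop t))"
      by (rule continuous_on_compose2[OF holomorphic_on_imp_continuous_on[OF hol]])
         (use c in \<open>auto intro!: continuous_intros simp: norm_mult\<close>)
    then have int: "set_integrable lborel {0..1} (\<lambda>t. g (c * unit_loop t))"
      by (rule borel_integrable_atLeastAtMost')
    have "contour_integral (p c) (\<lambda>z. g z / z) = integral {0..1} (\<lambda>t. 2 * of_real pi * \<i> * g (c * unit_loop t))"
      unfolding contour_integral_integral using c0
      by (intro integral_cong) (simp add: vector_derivative_at[OF der] p_def unit_loop_def)
    also have "\<dots> = 2 * of_real pi * \<i> * (LINT t:{0..1}|lborel. g (c * unit_loop t))"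
      by (subst set_borel_integral_eq_integral(2)[OF int]) simp
    also have "(LINT t:{0..1}|lborel. g (c * unit_loop t)) = (\<integral>u. g (c * u) \<partial>circle_measure)"
      by (rule integral_circle_measure[symmetric]) measurable
    finally show ?thesis .
  qed
  have "contour_integral (p a) (\<lambda>z. g z / z) = contour_integral (p b) (\<lambda>z. g z / z)"
  proof (rule Cauchy_theorem_homotopic_loops[OF _ oS _ vp vp])
    show "(\<lambda>z. g z / z) holomorphic_on S"
      using r by (intro holomorphic_intros hol[folded S_def]) (auto simp: S_def)
    have ab: "a \<noteq> 0" "b \<noteq> 0" using a b r by auto
    \<comment> \<open>Interpolating linearly between logarithms of a and b moves the centre-zero
      circle through a to the one through b. The modulus at time s is a geometric mean of the two
      radii, so it never leaves the range between them.\<close>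
    define h where "h = (\<lambda>(s, t). exp (of_real (1 - s) * Ln a + of_real s * Ln b) * unit_loop t)"
    have nrm: "norm (h (s, t)) = exp ((1 - s) * ln (norm a) + s * ln (norm b))" for s t
      using ab by (simp add: h_def norm_mult)
    have inS: "h (s, t) \<in> S" if "s \<in> {0..1}" for s t
    proof -
      define l where "l = ln (min (norm a) (norm b))"
      define m where "m = ln (max (norm a) (norm b))"
      have "ln (norm a) \<in> {l..m}" "ln (norm b) \<in> {l..m}"
        using ab by (auto simp: l_def m_def min_def max_def)
      then have "(1 - s) *\<^sub>R ln (norm a) + s *\<^sub>R ln (norm b) \<in> {l..m}"
        using that by (intro convexD convex_real_interval) auto
      then have "exp (ln (min (norm a) (norm b))) \<le> norm (h (s,t))"
        "norm (h (s,t)) \<le> exp (ln (max (norm a) (norm b)))"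
        unfolding nrm by (auto simp: l_def m_def)
      moreover have "r < min (norm a) (norm b)" "max (norm a) (norm b) < R" using a b by auto
      moreover have "exp (ln (max (norm a) (norm b))) = max (norm a) (norm b)"
        using ab by (intro exp_ln) (simp add: less_max_iff_disj)
      ultimately show ?thesis using ab by (auto simp: S_def)
    qed
    show "homotopic_loops S (p a) (p b)"
      unfolding homotopic_loops
    proof (intro exI[of _ h] conjI ballI)
      show "continuous_on ({0..1} \<times> {0..1}) h"
        unfolding h_def unit_loop_def case_prod_beta by (intro continuous_intros)
      show "h \<in> {0..1} \<times> {0..1} \<rightarrow> S" using inS by auto
      show "h (0, x) = p a x" "h (1, x) = p b x" for x
        using ab by (auto simp: h_def p_def)
      show "pathfinish (h \<circ> Pair t) = pathstart (h \<circ> Pair t)" for t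
        by (simp add: pathfinish_def pathstart_def h_def unit_loop_def)
    qed
  qed
  then show ?thesis using avg[of a] avg[of b] a b by simp
qed

lemma measurable_power_int_complex [measurable (raw)]:
  fixes f :: "'a \<Rightarrow> complex"
  assumes [measurable]: "f \<in> borel_measurable M"
  shows "(\<lambda>x. f x powi n) \<in> borel_measurable M"
  unfolding power_int_def by measurable

lemma measurable_cnj [measurable (raw)]:
  assumes [measurable]: "f \<in> borel_measurable M"
  shows "(\<lambda>x. cnj (f x)) \<in> borel_measurable M"
  by (rule measurable_compose[OF assms]) (intro borel_measurable_continuous_onI continuous_intros)

text \<open>Means over the circles of radius 1 and 2 agree, but homogeneity makes the second one 2^n
  times the first. For n nonzero this forces the mean to be 0.\<close>

lemma integral_circle_measure_power_int:
  "(\<integral>u. u powi n \<partial>circle_measure) = (if n = 0 then 1 else 0)"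
proof (cases "n = 0")
  case True
  then show ?thesis by (simp add: circle.prob_space[simplified])
next
  case False
  have "(\<integral>u. (1 * u) powi n \<partial>circle_measure) = (\<integral>u. (2 * u) powi n \<partial>circle_measure)"
    by (rule integral_circle_measure_annulus[where r=0 and R=3])
       (auto intro!: holomorphic_intros)
  then have "(\<integral>u. u powi n \<partial>circle_measure) = 2 powi n * (\<integral>u. u powi n \<partial>circle_measure)"
    by (simp add: power_int_mult_distrib)
  moreover have "(2::complex) powi n \<noteq> 1"
  proof
    assume "(2::complex) powi n = 1"
    then have "norm ((2::complex) powi n) = 1" by simp
    then have "(2::real) powi n = 1" by (simp add: norm_power_int)
    then have "2 powr real_of_int n = (1::real)" by (simp add: powr_real_of_int')
    then show False using False by (simp add: powr_eq_one_iff_gen)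
  qed
  ultimately show ?thesis using False by auto
qed

subsection \<open>Averages and Fourier coefficients on the unit torus\<close>

definition tmul :: "complex \<times> complex \<Rightarrow> complex \<times> complex \<Rightarrow> complex \<times> complex" where
  "tmul u z = (fst u * fst z, snd u * snd z)"

definition lmono :: "int \<times> int \<Rightarrow> complex \<times> complex \<Rightarrow> complex" where
  "lmono p z = fst z powi fst p * snd z powi snd p"

definition unit_torus :: "(complex \<times> complex) set" where
  "unit_torus = sphere 0 1 \<times> sphere 0 1"

definition torus_measure :: "(complex \<times> complex) measure" where
  "torus_measure = circle_measure \<Otimes>\<^sub>M circle_measure"

lemma sets_torus_measure [simp, measurable_cong]: "sets torus_measure = sets borel"
proof -
  have "sets torus_measure = sets (borel \<Otimes>\<^sub>M borel :: (complex \<times> complex) measure)"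
    unfolding torus_measure_def by (rule sets_pair_measure_cong) simp_all
  then show ?thesis unfolding borel_prod .
qed

lemma measurable_fst_borel [measurable (raw)]:
  fixes f :: "'a \<Rightarrow> complex \<times> complex"
  assumes "f \<in> borel_measurable M"
  shows "(\<lambda>x. fst (f x)) \<in> borel_measurable M" "(\<lambda>x. snd (f x)) \<in> borel_measurable M"
  using assms by (auto intro!: measurable_compose[OF assms] borel_measurable_continuous_onI continuous_intros)

lemma space_torus_measure [simp]: "space torus_measure = UNIV"
  by (simp add: torus_measure_def space_pair_measure)

lemma measurable_tmul [measurable (raw)]:
  assumes [measurable]: "f \<in> borel_measurable M" "g \<in> borel_measurable M"
  shows "(\<lambda>x. tmul (f x) (g x)) \<in> borel_measurable M"
  unfolding tmul_def by measurable

lemma measurable_lmono [measurable (raw)]: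
  assumes [measurable]: "f \<in> borel_measurable M"
  shows "(\<lambda>x. lmono p (f x)) \<in> borel_measurable M"
  unfolding lmono_def by measurable

interpretation circle_pair: pair_prob_space circle_measure circle_measure ..

interpretation torus: prob_space torus_measure
  unfolding torus_measure_def by (rule circle_pair.prob_space_axioms)

lemma in_unit_torus_iff: "u \<in> unit_torus \<longleftrightarrow> norm (fst u) = 1 \<and> norm (snd u) = 1"
  by (cases u) (simp add: unit_torus_def)

lemma compact_unit_torus: "compact unit_torus"
  by (simp add: unit_torus_def compact_Times)

lemma AE_torus: "AE u in torus_measure. u \<in> unit_torus"
proof -
  have "closed unit_torus" by (intro compact_imp_closed compact_unit_torus)
  then have [measurable]: "unit_torus \<in> sets borel" by simp
  have "{x \<in> space (circle_measure \<Otimes>\<^sub>M circle_measure). x \<in> unit_torus} \<in> sets torus_measure"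
    by (simp add: space_pair_measure)
  then show ?thesis
    unfolding torus_measure_def
    by (intro circle_pair.AE_pair_measure)
       (use AE_circle_norm in \<open>auto simp: in_unit_torus_iff torus_measure_def elim!: eventually_mono\<close>)
qed

lemma integrable_torus_bounded:
  fixes f :: "complex \<times> complex \<Rightarrow> 'b::{banach, second_countable_topology}"
  assumes "f \<in> borel_measurable borel" "\<And>u. u \<in> unit_torus \<Longrightarrow> norm (f u) \<le> B"
  shows "integrable torus_measure f"
  using assms AE_torus
  by (intro torus.integrable_const_bound[of _ B]) (auto elim!: eventually_mono simp: measurable_def)

lemma integrable_torus:
  fixes f :: "complex \<times> complex \<Rightarrow> 'b::{banach, second_countable_topology}"
  assumes "f \<in> borel_measurable borel" "continuous_on unit_torus f"
  shows "integrable torus_measure f"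
proof -
  have "bounded (f ` unit_torus)"
    by (intro compact_imp_bounded compact_continuous_image assms compact_unit_torus)
  then obtain B where "\<And>u. u \<in> unit_torus \<Longrightarrow> norm (f u) \<le> B"
    unfolding bounded_iff by blast
  then show ?thesis by (rule integrable_torus_bounded[OF assms(1)])
qed

lemma continuous_on_lmono_torus [continuous_intros]: "continuous_on unit_torus (lmono p)"
  unfolding lmono_def
  by (intro continuous_intros) (auto simp: in_unit_torus_iff)

lemma norm_lmono_torus: "u \<in> unit_torus \<Longrightarrow> norm (lmono p u) = 1"
  by (simp add: lmono_def norm_mult norm_power_int in_unit_torus_iff)

lemma lmono_add:
  "fst z \<noteq> 0 \<Longrightarrow> snd z \<noteq> 0 \<Longrightarrow> lmono (p + q) z = lmono p z * lmono q z"
  by (simp add: lmono_def power_int_add)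

lemma integral_torus_iterated:
  fixes f :: "complex \<times> complex \<Rightarrow> complex"
  assumes "integrable torus_measure f"
  shows "integral\<^sup>L torus_measure f = (\<integral>v. (\<integral>u. f (u, v) \<partial>circle_measure) \<partial>circle_measure)"
    and "integral\<^sup>L torus_measure f = (\<integral>u. (\<integral>v. f (u, v) \<partial>circle_measure) \<partial>circle_measure)"
  using circle_pair.integral_fst[of "curry f"] circle_pair.integral_snd[of "curry f"] assms
  by (simp_all add: torus_measure_def)

lemma integral_torus_lmono: "(\<integral>u. lmono p u \<partial>torus_measure) = (if p = 0 then 1 else 0)"
proof -
  have "(\<integral>u. lmono p u \<partial>torus_measure) =
      (\<integral>v. (\<integral>u. u powi fst p * v powi snd p \<partial>circle_measure) \<partial>circle_measure)"
    by (subst integral_torus_iterated(1))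
       (auto intro!: integrable_torus continuous_intros simp: lmono_def)
  also have "\<dots> = (if p = 0 then 1 else 0)"
    by (simp add: integral_circle_measure_power_int prod_eq_iff)
  finally show ?thesis .
qed

text \<open>The circle version is used twice: by Fubini, for almost every first coordinate the
  function vanishes for all second coordinates, and then continuity in the first coordinate removes
  the remaining exceptions.\<close>

lemma AE_torus_eq_0D:
  fixes f :: "complex \<times> complex \<Rightarrow> complex"
  assumes [measurable]: "f \<in> borel_measurable borel" and cont: "continuous_on unit_torus f"
    and ae: "AE u in torus_measure. f u = 0" and u: "u \<in> unit_torus"
  shows "f u = 0"
proof -
  have m: "(\<lambda>v. f (a, v)) \<in> borel_measurable borel" "(\<lambda>v. f (v, a)) \<in> borel_measurable borel" for a
    by measurable
  have c: "continuous_on (sphere 0 1) (\<lambda>v. f (a, v))" "continuous_on (sphere 0 1) (\<lambda>v. f (v, a))"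
    if "norm a = 1" for a
    using that by (auto intro!: continuous_on_compose2[OF cont] continuous_intros simp: in_unit_torus_iff)
  have "AE a in circle_measure. AE v in circle_measure. f (a, v) = 0"
    using circle_pair.AE_pair[OF ae[unfolded torus_measure_def]] by simp
  then have "AE a in circle_measure. norm a = 1 \<and> (\<forall>v. norm v = 1 \<longrightarrow> f (a, v) = 0)"
    using AE_circle_norm by eventually_elim (use AE_circle_eq_0D m c in blast)
  then have "AE a in circle_measure. f (a, snd u) = 0"
    by eventually_elim (use u in \<open>auto simp: in_unit_torus_iff\<close>)
  then have "f (fst u, snd u) = 0"
    using u by (intro AE_circle_eq_0D[of "\<lambda>a. f (a, snd u)"] m c) (auto simp: in_unit_torus_iff)
  then show ?thesis by simp
qed

section \<open>Uniqueness of Fourier coefficients on the torus\<close>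

text \<open>This class is closed under multiplication by real polynomials in the real coordinates, which on
  the torus are Laurent polynomials; hence Stone--Weierstrass forces its members to vanish.\<close>
definition fourier_null :: "(complex \<times> complex \<Rightarrow> complex) \<Rightarrow> bool" where
  "fourier_null f \<longleftrightarrow> f \<in> borel_measurable borel \<and> continuous_on unit_torus f \<and>
     (\<forall>p. (\<integral>u. f u * lmono p u \<partial>torus_measure) = 0)"

lemma integrable_fourier_null:
  assumes "fourier_null f"
  shows "integrable torus_measure (\<lambda>u. f u * lmono p u)"
  using assms by (intro integrable_torus continuous_intros) (auto simp: fourier_null_def)

lemma fourier_null_add:
  assumes "fourier_null f" "fourier_null g"
  shows "fourier_null (\<lambda>u. f u + g u)"
  using assms integrable_fourier_null[OF assms(1)] integrable_fourier_null[OF assms(2)]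
  by (auto simp: fourier_null_def distrib_right intro!: continuous_intros)

lemma fourier_null_cmult:
  assumes "fourier_null f"
  shows "fourier_null (\<lambda>u. c * f u)"
  using assms by (auto simp: fourier_null_def mult.assoc intro!: continuous_intros)

lemma fourier_null_cong:
  assumes "fourier_null f" "g \<in> borel_measurable borel" "\<And>u. u \<in> unit_torus \<Longrightarrow> g u = f u"
  shows "fourier_null g"
proof -
  have [measurable]: "f \<in> borel_measurable borel" "g \<in> borel_measurable borel"
    using assms by (auto simp: fourier_null_def)
  have "(\<integral>u. g u * lmono p u \<partial>torus_measure) = (\<integral>u. f u * lmono p u \<partial>torus_measure)" for p
    by (intro integral_cong_AE) (use AE_torus assms(3) in \<open>auto elim!: eventually_mono\<close>)
  moreover have "continuous_on unit_torus g"
    using assms continuous_on_cong[of unit_torus unit_torus g f] by (simp add: fourier_null_def)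
  ultimately show ?thesis using assms by (simp add: fourier_null_def)
qed

lemma fourier_null_lmono:
  assumes "fourier_null f"
  shows "fourier_null (\<lambda>u. lmono p u * f u)"
proof -
  have [measurable]: "f \<in> borel_measurable borel"
    using assms by (auto simp: fourier_null_def)
  have "(\<integral>u. lmono p u * f u * lmono q u \<partial>torus_measure) = (\<integral>u. f u * lmono (p + q) u \<partial>torus_measure)" for q
  proof (intro integral_cong_AE)
    show "AE u in torus_measure. lmono p u * f u * lmono q u = f u * lmono (p + q) u"
      using AE_torus
    proof eventually_elim
      case (elim u)
      then have "fst u \<noteq> 0" "snd u \<noteq> 0" by (auto simp: in_unit_torus_iff)
      then show ?case by (simp add: lmono_add)
    qed
  qed measurable
  then show ?thesis
    using assms unfolding fourier_null_def
    by (auto simp del: split_paired_All intro!: continuous_intros)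
qed

lemma fourier_null_linear:
  fixes h :: "complex \<times> complex \<Rightarrow> real"
  assumes "bounded_linear h" and f: "fourier_null f"
  shows "fourier_null (\<lambda>u. of_real (h u) * f u)"
proof -
  have lin: "linear h" using assms(1) by (simp add: bounded_linear.linear)
  have [measurable]: "h \<in> borel_measurable borel" "f \<in> borel_measurable borel"
    using assms by (auto simp: fourier_null_def intro!: borel_measurable_continuous_onI linear_continuous_on)
  define x y x' y' where "x = h (1, 0)" and "y = h (\<i>, 0)" and "x' = h (0, 1)" and "y' = h (0, \<i>)"
  \<comment> \<open>A real-linear functional x Re(a) + y Im(a) equals A a + cnj(A) cnj(a) for A = (x
    - i y)/2. On the unit circle cnj(a) is the inverse of a, which makes the functional a Laurent
    polynomial.\<close>
  define A where "A = (of_real x - \<i> * of_real y) / 2"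
  define A' where "A' = (of_real x' - \<i> * of_real y') / 2"
  define g where "g u = A * (lmono (1, 0) u * f u) + cnj A * (lmono (-1, 0) u * f u) +
      (A' * (lmono (0, 1) u * f u) + cnj A' * (lmono (0, -1) u * f u))" for u
  have g: "fourier_null g"
    unfolding g_def by (intro fourier_null_add fourier_null_cmult fourier_null_lmono f)
  show ?thesis
  proof (rule fourier_null_cong[OF g])
    show "(\<lambda>u. of_real (h u) * f u) \<in> borel_measurable borel" by measurable
    fix u assume u: "u \<in> unit_torus"
    obtain a b where ab: "u = (a, b)" "norm a = 1" "norm b = 1"
      using u by (cases u) (auto simp: in_unit_torus_iff)
    have inv: "inverse a = cnj a" "inverse b = cnj b"
      using ab by (auto intro!: inverse_unique simp: complex_norm_square[symmetric])
    have u_eq: "u = (Re a *\<^sub>R (1, 0) + Im a *\<^sub>R (\<i>, 0)) + (Re b *\<^sub>R (0, 1) + Im b *\<^sub>R (0, \<i>))"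
      unfolding ab by (auto simp: complex_eq_iff)
    have "h u = (Re a * x + Im a * y) + (Re b * x' + Im b * y')"
      unfolding u_eq by (simp only: linear_add[OF lin] linear_scale[OF lin] real_scaleR_def x_def y_def x'_def y'_def)
    moreover have "of_real (Re a * x + Im a * y) = A * a + cnj A * cnj a"
      "of_real (Re b * x' + Im b * y') = A' * b + cnj A' * cnj b"
      by (simp_all add: complex_eq_iff A_def A'_def field_simps)
    ultimately have hu: "of_real (h u) = (A * a + cnj A * cnj a) + (A' * b + cnj A' * cnj b)"
      by (simp only: of_real_add)
    show "of_real (h u) * f u = g u"
      unfolding hu g_def by (simp add: lmono_def ab power_int_minus inv algebra_simps)
  qed
qed

lemma fourier_null_polynomial:
  assumes "real_polynomial_function p" "fourier_null f"
  shows "fourier_null (\<lambda>u. of_real (p u) * f u)"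
  using assms
\<comment> \<open>The function f must vary: in the product case the hypothesis for \<open>p\<close>
  is applied to q times f.\<close>
proof (induction arbitrary: f rule: real_polynomial_function.induct)
  case (linear h)
  then show ?case by (rule fourier_null_linear)
next
  case (const c)
  then show ?case by (rule fourier_null_cmult)
next
  case (add p q)
  then show ?case using fourier_null_add[OF add.IH(1) add.IH(2)] by (simp add: distrib_right)
next
  case (mult p q)
  then show ?case using mult.IH(1)[OF mult.IH(2)] by (simp add: mult.assoc)
qed

text \<open>If p - i q approximates the conjugate of f uniformly on the torus, then (p - i q) f has
  integral 0 and is close to the squared modulus of f. Hence the integral of the latter is
  arbitrarily small, and continuity gives vanishing everywhere on the torus.\<close>

lemma fourier_null_eq_0:
  assumes "fourier_null f" "u \<in> unit_torus"
  shows "f u = 0"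
proof -
  have [measurable]: "f \<in> borel_measurable borel" and cont: "continuous_on unit_torus f"
    using assms(1) by (auto simp: fourier_null_def)
  define I where "I = (\<integral>u. f u * cnj (f u) \<partial>torus_measure)"
  have "bounded (f ` unit_torus)"
    by (intro compact_imp_bounded compact_continuous_image cont compact_unit_torus)
  then obtain B where B: "B > 0" "\<And>u. u \<in> unit_torus \<Longrightarrow> norm (f u) \<le> B"
    unfolding bounded_pos by blast
  have "norm I \<le> e" if "e > 0" for e
  proof -
    \<comment> \<open>The real and imaginary parts each contribute an error of at most d, multiplied
      by the bound B for f; thus B (d + d) = e.\<close>
    define d where "d = e / (2 * B)"
    have d: "d > 0" using that B by (simp add: d_def)
    have cr: "continuous_on unit_torus (\<lambda>u. Re (f u))" "continuous_on unit_torus (\<lambda>u. Im (f u))"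
      by (intro continuous_intros cont)+
    obtain p where p: "real_polynomial_function p" "\<And>u. u \<in> unit_torus \<Longrightarrow> \<bar>Re (f u) - p u\<bar> < d"
      using Stone_Weierstrass_real_polynomial_function[OF compact_unit_torus cr(1) d] by blast
    obtain q where q: "real_polynomial_function q" "\<And>u. u \<in> unit_torus \<Longrightarrow> \<bar>Im (f u) - q u\<bar> < d"
      using Stone_Weierstrass_real_polynomial_function[OF compact_unit_torus cr(2) d] by blast
    have cp: "continuous_on S p" "continuous_on S q" for S
      using p q by (auto intro!: continuous_on_polymonial_function simp: real_polynomial_function_eq)
    then have [measurable]: "p \<in> borel_measurable borel" "q \<in> borel_measurable borel"
      by (auto intro!: borel_measurable_continuous_onI)
    define g where "g u = of_real (p u) * f u + (- \<i>) * (of_real (q u) * f u)" for u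
    have g: "fourier_null g"
      unfolding g_def
      by (intro fourier_null_add fourier_null_cmult fourier_null_polynomial p q assms(1))
    have [measurable]: "g \<in> borel_measurable borel" and cg: "continuous_on unit_torus g"
      using g by (simp_all add: fourier_null_def)
    have "(\<integral>u. g u * lmono (0, 0) u \<partial>torus_measure) = 0"
      using g unfolding fourier_null_def by blast
    then have g0: "(\<integral>u. g u \<partial>torus_measure) = 0" by (simp add: lmono_def)
    have "integrable torus_measure (\<lambda>u. f u * cnj (f u))"
      by (intro integrable_torus continuous_intros cont; measurable)
    moreover have "integrable torus_measure g"
      by (intro integrable_torus cg; measurable)
    ultimately have "I = (\<integral>u. f u * cnj (f u) - g u \<partial>torus_measure)"
      unfolding I_def using g0 by simp
    also have "norm \<dots> \<le> (\<integral>u. norm (f u * cnj (f u) - g u) \<partial>torus_measure)"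
      by (rule integral_norm_bound)
    also have "\<dots> \<le> (\<integral>u. e \<partial>torus_measure)"
    proof (rule integral_mono_AE)
      show "integrable torus_measure (\<lambda>u. norm (f u * cnj (f u) - g u))"
        by (intro integrable_torus continuous_intros cont cg; measurable)
      show "AE u in torus_measure. norm (f u * cnj (f u) - g u) \<le> e"
        using AE_torus
      proof eventually_elim
        case (elim u)
        have "f u * cnj (f u) - g u = f u * (of_real (Re (f u) - p u) - \<i> * of_real (Im (f u) - q u))"
          by (simp add: g_def complex_eq_iff algebra_simps)
        also have "norm \<dots> \<le> B * (\<bar>Re (f u) - p u\<bar> + \<bar>Im (f u) - q u\<bar>)"
          unfolding norm_mult
          using B(1) B(2)[OF elim] norm_triangle_ineq4[of "of_real (Re (f u) - p u)" "\<i> * of_real (Im (f u) - q u)"]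
          by (intro mult_mono) (auto simp: norm_mult simp del: of_real_diff)
        also have "\<dots> \<le> B * (d + d)"
          using B p(2)[OF elim] q(2)[OF elim] by (intro mult_left_mono) auto
        also have "\<dots> = e" using B by (simp add: d_def)
        finally show ?case .
      qed
    qed auto
    also have "\<dots> = e" by (simp add: torus.prob_space[simplified])
    finally show ?thesis .
  qed
  then have "norm I \<le> 0" by (rule field_le_epsilon) simp
  then have "I = 0" by simp
  have "of_real (\<integral>u. (norm (f u))\<^sup>2 \<partial>torus_measure) = I"
    unfolding I_def integral_complex_of_real[symmetric] complex_norm_square ..
  then have 0: "(\<integral>u. (norm (f u))\<^sup>2 \<partial>torus_measure) = 0"
    unfolding \<open>I = 0\<close> of_real_eq_0_iff .
  have "integrable torus_measure (\<lambda>u. (norm (f u))\<^sup>2)"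
    by (intro integrable_torus continuous_intros cont; measurable)
  then have "AE u in torus_measure. (norm (f u))\<^sup>2 = 0"
    using 0 by (subst (asm) integral_nonneg_eq_0_iff_AE) auto
  then have "AE u in torus_measure. f u = 0" by simp
  then show ?thesis using assms(2) cont by (intro AE_torus_eq_0D) auto
qed

text \<open>Absolute summability makes the series converge uniformly to a continuous function
  \<open>g\<close>, whose coefficients can be computed termwise. Since f and \<open>g\<close> have
  the same coefficients, uniqueness identifies them.\<close>

lemma fourier_series_torus:
  fixes f :: "complex \<times> complex \<Rightarrow> complex"
  assumes f_borel [measurable]: "f \<in> borel_measurable borel" and cont: "continuous_on unit_torus f"
    and coeff: "\<And>p. (\<integral>u. f u * lmono (- p) u \<partial>torus_measure) = c p"
    and summ: "(\<lambda>p. norm (c p)) summable_on UNIV" and u: "u \<in> unit_torus"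
  shows "f u = (\<Sum>\<^sub>\<infinity>p. c p * lmono p u)"
proof -
  \<comment> \<open>Enumerating the index lattice turns the unordered sum into an ordinary series,
    to which the Weierstrass test and termwise integration apply.\<close>
  define idx :: "nat \<Rightarrow> int \<times> int" where "idx = from_nat_into UNIV"
  have bij: "bij_betw idx UNIV UNIV"
    unfolding idx_def by (rule bij_betw_from_nat_into) (auto simp: finite_prod)
  define s where "s k v = c (idx k) * lmono (idx k) v" for k v
  have sumc: "summable (\<lambda>k. norm (c (idx k)))"
  proof -
    have "(\<lambda>k. norm (c (idx k))) summable_on UNIV"
      using summable_on_reindex_bij_betw[OF bij, of "\<lambda>p. norm (c p)"] summ by blast
    then show ?thesis by (rule summable_on_imp_summable)
  qed
  have [measurable]: "s k \<in> borel_measurable borel" for k unfolding s_def by measurable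
  define g where "g v = (\<Sum>k. s k v)" for v
  have [measurable]: "g \<in> borel_measurable borel" unfolding g_def by measurable
  have nrm: "norm (s k v) = norm (c (idx k))" if "v \<in> unit_torus" for k v
    by (simp add: s_def norm_mult norm_lmono_torus[OF that])
  have gcont: "continuous_on unit_torus g"
  proof (rule uniform_limit_theorem)
    show "uniform_limit unit_torus (\<lambda>n v. \<Sum>k<n. s k v) g sequentially"
      unfolding g_def by (rule Weierstrass_m_test[OF _ sumc]) (simp add: nrm)
    show "\<forall>\<^sub>F n in sequentially. continuous_on unit_torus (\<lambda>v. \<Sum>k<n. s k v)"
      unfolding s_def by (intro always_eventually allI continuous_intros)
  qed simp
  have gcoeff: "(\<integral>v. g v * lmono (- p) v \<partial>torus_measure) = c p" for p
  proof -
    obtain k0 where k0: "idx k0 = p" using bij by (metis UNIV_I bij_betw_iff_bijections)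
    have injd: "idx k = p \<longleftrightarrow> k = k0" for k
      using k0 bij_is_inj[OF bij] by (metis injD)
    have sums: "(\<lambda>k. s k v * lmono (- p) v) sums (g v * lmono (- p) v)" if "v \<in> unit_torus" for v
    proof -
      have "summable (\<lambda>k. norm (s k v))" unfolding nrm[OF that] by (rule sumc)
      then show ?thesis
        unfolding g_def by (rule sums_mult2[OF summable_sums[OF summable_norm_cancel]])
    qed
    have int: "(\<integral>v. s k v * lmono (- p) v \<partial>torus_measure) = (if k = k0 then c p else 0)" for k
    proof -
      have "(\<integral>v. s k v * lmono (- p) v \<partial>torus_measure) = (\<integral>v. c (idx k) * lmono (idx k - p) v \<partial>torus_measure)"
      proof (intro integral_cong_AE)
        show "AE v in torus_measure. s k v * lmono (- p) v = c (idx k) * lmono (idx k - p) v"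
          using AE_torus
        proof eventually_elim
          case (elim v)
          then have "fst v \<noteq> 0" "snd v \<noteq> 0" by (auto simp: in_unit_torus_iff)
          then show ?case using lmono_add[of v "idx k" "- p"] by (simp add: s_def)
        qed
      qed measurable
      also have "\<dots> = (if k = k0 then c p else 0)"
        using injd[of k] k0 by (simp add: integral_torus_lmono)
      finally show ?thesis .
    qed
    have ints: "integrable torus_measure (\<lambda>v. s k v * lmono (- p) v)" for k
      by (rule integrable_torus_bounded[of _ "norm (c (idx k))"])
         (measurable, simp add: norm_mult nrm norm_lmono_torus)
    have "(\<integral>v. g v * lmono (- p) v \<partial>torus_measure) = (\<integral>v. (\<Sum>k. s k v * lmono (- p) v) \<partial>torus_measure)"
    proof (intro integral_cong_AE)
      show "AE v in torus_measure. g v * lmono (- p) v = (\<Sum>k. s k v * lmono (- p) v)"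
        using AE_torus by eventually_elim (rule sums_unique[OF sums])
    qed measurable
    also have "\<dots> = (\<Sum>k. (\<integral>v. s k v * lmono (- p) v \<partial>torus_measure))"
    proof (rule integral_suminf[OF ints])
      show "AE v in torus_measure. summable (\<lambda>k. norm (s k v * lmono (- p) v))"
        using AE_torus 
        by eventually_elim (simp only: norm_mult nrm norm_lmono_torus mult_1_right sumc)
      have "(\<integral>v. norm (s k v * lmono (- p) v) \<partial>torus_measure) = norm (c (idx k))" for k
      proof -
        have "(\<integral>v. norm (s k v * lmono (- p) v) \<partial>torus_measure) = (\<integral>v. norm (c (idx k)) \<partial>torus_measure)"
        proof (intro integral_cong_AE)
          show "AE v in torus_measure. norm (s k v * lmono (- p) v) = norm (c (idx k))"
            using AE_torus by eventually_elim (simp add: norm_mult nrm norm_lmono_torus)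
        qed measurable
        then show ?thesis by (simp add: torus.prob_space[simplified])
      qed
      then show "summable (\<lambda>k. \<integral>v. norm (s k v * lmono (- p) v) \<partial>torus_measure)"
        by (simp only: sumc)
    qed
    also have "\<dots> = c p" unfolding int by (rule sums_unique[OF sums_single, symmetric])
    finally show ?thesis .
  qed
  have "fourier_null (\<lambda>v. f v - g v)"
    unfolding fourier_null_def
  proof (intro conjI allI)
    fix p
    have "integrable torus_measure (\<lambda>v. f v * lmono p v)" "integrable torus_measure (\<lambda>v. g v * lmono p v)"
      by (intro integrable_torus continuous_intros cont gcont; measurable)+
    then show "(\<integral>v. (f v - g v) * lmono p v \<partial>torus_measure) = 0"
      using coeff[of "- p"] gcoeff[of "- p"] by (simp add: left_diff_distrib)
  qed (measurable, intro continuous_intros cont gcont)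
  then have "f u - g u = 0" using u by (rule fourier_null_eq_0)
  then have "f u = g u" by simp
  also have "\<dots> = (\<Sum>\<^sub>\<infinity>k. s k u)"
    unfolding g_def
  proof (rule infsumI[OF norm_summable_imp_has_sum, symmetric])
    show sn: "summable (\<lambda>k. norm (s k u))" unfolding nrm[OF u] by (rule sumc)
    show "(\<lambda>k. s k u) sums (\<Sum>k. s k u)"
      by (rule summable_sums[OF summable_norm_cancel[OF sn]])
  qed
  also have "\<dots> = (\<Sum>\<^sub>\<infinity>p. c p * lmono p u)"
    unfolding s_def by (rule infsum_reindex_bij_betw[OF bij])
  finally show ?thesis .
qed

subsection \<open>Square-integrable holomorphic functions of two variables\<close>

lemma continuous_on_tmul: "continuous_on UNIV (\<lambda>u. tmul u z)"
  unfolding tmul_def by (intro continuous_intros)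

lemma norm_tmul:
  assumes "u \<in> unit_torus"
  shows "norm (fst (tmul u z)) = norm (fst z)" "norm (snd (tmul u z)) = norm (snd z)"
  using assms by (auto simp: tmul_def norm_mult in_unit_torus_iff)

lemma orthogonal_transformation_tmul:
  assumes "u \<in> unit_torus"
  shows "orthogonal_transformation (tmul u)"
  unfolding orthogonal_transformation
proof (intro conjI allI)
  show "linear (tmul u)"
    by (auto simp: linear_iff tmul_def algebra_simps)
  show "norm (tmul u v) = norm v" for v
    using norm_tmul[OF assms, of v] by (simp add: norm_prod_def)
qed

lemma nn_integral_lborel_tmul:
  assumes [measurable]: "F \<in> borel_measurable borel" and u: "u \<in> unit_torus"
  shows "(\<integral>\<^sup>+z. F (tmul u z) \<partial>lborel) = (\<integral>\<^sup>+z. F z \<partial>lborel)"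
proof -
  have "(\<integral>\<^sup>+z. F z \<partial>lborel) = (\<integral>\<^sup>+z. F z \<partial>distr lborel borel (tmul u))"
    by (simp add: lborel_distr_orthogonal orthogonal_transformation_tmul u)
  also have "\<dots> = (\<integral>\<^sup>+z. F (tmul u z) \<partial>lborel)"
    by (rule nn_integral_distr) measurable
  finally show ?thesis by simp
qed

lemma integral_lborel_tmul:
  fixes F :: "complex \<times> complex \<Rightarrow> complex"
  assumes [measurable]: "F \<in> borel_measurable borel" and u: "u \<in> unit_torus"
  shows "(\<integral>z. F (tmul u z) \<partial>lborel) = (\<integral>z. F z \<partial>lborel)"
proof -
  have "(\<integral>z. F z \<partial>lborel) = (\<integral>z. F z \<partial>distr lborel borel (tmul u))"
    by (simp add: lborel_distr_orthogonal orthogonal_transformation_tmul u)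
  also have "\<dots> = (\<integral>z. F (tmul u z) \<partial>lborel)"
    by (rule integral_distr) measurable
  finally show ?thesis by simp
qed

interpretation torus_lborel: pair_sigma_finite torus_measure "lborel :: (complex \<times> complex) measure" ..

text \<open>After interchanging the integrals, the inner integral over C^2 does not depend on the
  torus element, and the torus has total mass 1.\<close>

lemma nn_integral_lborel_torus_average:
  assumes [measurable]: "F \<in> borel_measurable borel"
  shows "(\<integral>\<^sup>+z. (\<integral>\<^sup>+u. F (tmul u z) \<partial>torus_measure) \<partial>lborel) = (\<integral>\<^sup>+z. F z \<partial>lborel)"
proof -
  have "(\<integral>\<^sup>+z. (\<integral>\<^sup>+u. F (tmul u z) \<partial>torus_measure) \<partial>lborel) = (\<integral>\<^sup>+u. (\<integral>\<^sup>+z. F (tmul u z) \<partial>lborel) \<partial>torus_measure)"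
    by (rule torus_lborel.Fubini') measurable
  also have "\<dots> = (\<integral>\<^sup>+u. (\<integral>\<^sup>+z. F z \<partial>lborel) \<partial>torus_measure)"
  proof (rule nn_integral_cong_AE)
    show "AE u in torus_measure. (\<integral>\<^sup>+z. F (tmul u z) \<partial>lborel) = (\<integral>\<^sup>+z. F z \<partial>lborel)"
      using AE_torus by eventually_elim (simp add: nn_integral_lborel_tmul)
  qed
  finally show ?thesis by (simp add: torus.emeasure_space_1[simplified])
qed

lemma integral_lborel_torus_average:
  fixes F :: "complex \<times> complex \<Rightarrow> complex"
  assumes int: "integrable lborel F"
  shows "(\<integral>z. (\<integral>u. F (tmul u z) \<partial>torus_measure) \<partial>lborel) = (\<integral>z. F z \<partial>lborel)"
proof -
  have [measurable]: "F \<in> borel_measurable borel" using int by simp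
  \<comment> \<open>The nonnegative averaging identity, applied to the modulus of F, supplies the
    joint integrability that Fubini's theorem requires.\<close>
  have "(\<integral>\<^sup>+x. norm (case x of (u, z) \<Rightarrow> F (tmul u z)) \<partial>(torus_measure \<Otimes>\<^sub>M lborel))
      = (\<integral>\<^sup>+z. (\<integral>\<^sup>+u. norm (F (tmul u z)) \<partial>torus_measure) \<partial>lborel)"
    by (subst torus_lborel.nn_integral_snd[symmetric]) simp_all
  also have "\<dots> = (\<integral>\<^sup>+z. norm (F z) \<partial>lborel)"
    by (rule nn_integral_lborel_torus_average) measurable
  also have "\<dots> < \<infinity>" using int by (simp add: integrable_iff_bounded)
  finally have int2: "integrable (torus_measure \<Otimes>\<^sub>M lborel) (\<lambda>(u, z). F (tmul u z))"
    by (simp add: integrable_iff_bounded)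
  have "(\<integral>z. (\<integral>u. F (tmul u z) \<partial>torus_measure) \<partial>lborel) = (\<integral>u. (\<integral>z. F (tmul u z) \<partial>lborel) \<partial>torus_measure)"
    by (rule torus_lborel.Fubini_integral[OF int2])
  also have "\<dots> = (\<integral>u. (\<integral>z. F z \<partial>lborel) \<partial>torus_measure)"
  proof (rule integral_cong_AE)
    show "AE u in torus_measure. (\<integral>z. F (tmul u z) \<partial>lborel) = (\<integral>z. F z \<partial>lborel)"
      using AE_torus by eventually_elim (simp add: integral_lborel_tmul)
  qed measurable
  finally show ?thesis by (simp add: torus.prob_space[simplified])
qed

lemma AE_lborel_fst_neq_0: "AE z in lborel. fst (z :: complex \<times> complex) \<noteq> 0"
proof -
  have "AE z in (lborel :: complex measure) \<Otimes>\<^sub>M (lborel :: complex measure). fst z \<noteq> 0"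
  proof (rule lborel_pair.AE_pair_measure)
    show "{x \<in> space ((lborel :: complex measure) \<Otimes>\<^sub>M (lborel :: complex measure)). fst x \<noteq> 0} \<in> sets (lborel \<Otimes>\<^sub>M lborel)"
      by measurable
  qed (use AE_lborel_singleton[of "0::complex"] in auto)
  then show ?thesis unfolding lborel_prod .
qed

section \<open>Holomorphy in two variables and extension by zero\<close>

lemma holomorphic2_on_imp_continuous_on: "holomorphic2_on f S \<Longrightarrow> continuous_on S f"
  unfolding holomorphic2_on_def
  by (intro continuous_at_imp_continuous_on) (blast intro: has_derivative_continuous)

lemma holomorphic2_on_slices:
  assumes "holomorphic2_on f S"
  shows "(\<lambda>a. f (a, b)) holomorphic_on {a. (a, b) \<in> S}" "(\<lambda>b. f (a, b)) holomorphic_on {b. (a, b) \<in> S}"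
proof -
  have "\<exists>d. ((\<lambda>a. f (a, b)) has_field_derivative d) (at a within T)" if "(a, b) \<in> S" for a b T
  proof -
    obtain c d where "(f has_derivative (\<lambda>h. c * fst h + d * snd h)) (at (a, b))"
      using assms \<open>(a, b) \<in> S\<close> unfolding holomorphic2_on_def by blast
    then have "((\<lambda>a. f (a, b)) has_derivative (\<lambda>h. c * h)) (at a within T)"
      by (rule has_derivative_compose[where f="\<lambda>a. (a, b)" and s=T, THEN has_derivative_eq_rhs, rotated])
         (auto intro!: derivative_eq_intros)
    then show ?thesis by (auto simp: has_field_derivative_def)
  qed
  then show "(\<lambda>a. f (a, b)) holomorphic_on {a. (a, b) \<in> S}"
    by (auto simp: holomorphic_on_def field_differentiable_def)
  have "\<exists>d. ((\<lambda>b. f (a, b)) has_field_derivative d) (at b within T)" if "(a, b) \<in> S" for a b T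
  proof -
    obtain c d where "(f has_derivative (\<lambda>h. c * fst h + d * snd h)) (at (a, b))"
      using assms \<open>(a, b) \<in> S\<close> unfolding holomorphic2_on_def by blast
    then have "((\<lambda>b. f (a, b)) has_derivative (\<lambda>h. d * h)) (at b within T)"
      by (rule has_derivative_compose[where f="\<lambda>b. (a, b)" and s=T, THEN has_derivative_eq_rhs, rotated])
         (auto intro!: derivative_eq_intros)
    then show ?thesis by (auto simp: has_field_derivative_def)
  qed
  then show "(\<lambda>b. f (a, b)) holomorphic_on {b. (a, b) \<in> S}"
    by (auto simp: holomorphic_on_def field_differentiable_def)
qed

lemma open_H_gamma:
  assumes "\<gamma> > 0"
  shows "open (H_gamma \<gamma>)"
  unfolding H_gamma_def using assms
  by (intro open_Collect_conj open_Collect_less continuous_intros continuous_on_powr') auto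

lemma H_gamma_snd_neq_0: "z \<in> H_gamma \<gamma> \<Longrightarrow> snd z \<noteq> 0"
  by (auto simp: H_gamma_def)

lemma tmul_in_H_gamma_iff: "u \<in> unit_torus \<Longrightarrow> tmul u z \<in> H_gamma \<gamma> \<longleftrightarrow> z \<in> H_gamma \<gamma>"
  by (simp add: H_gamma_def norm_tmul)

text \<open>Extending by 0 lets integrals over the domain become integrals over all of C^2, where
  the torus action and Fubini's theorem are formulated.\<close>

definition zero_ext :: "'a set \<Rightarrow> ('a \<Rightarrow> complex) \<Rightarrow> 'a \<Rightarrow> complex" where
  "zero_ext S f z = (if z \<in> S then f z else 0)"

lemma measurable_zero_ext:
  assumes "continuous_on S f" "open S"
  shows "zero_ext S f \<in> borel_measurable borel"
  unfolding zero_ext_def using assms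
  by (intro borel_measurable_continuous_on_if) auto

text \<open>The zero extension is Borel because the domain is open and the function is continuous
  there. Completing the measure does not affect the integrability of Borel functions, so
  \<open>lebesgue\<close> can be traded for \<open>lborel\<close>, for which product decompositions
  are at hand.\<close>

lemma bergman_space_iff:
  assumes "open S"
  shows "f \<in> bergman_space S \<longleftrightarrow> holomorphic2_on f S \<and> integrable lborel (\<lambda>z. (norm (zero_ext S f z))\<^sup>2)"
proof -
  have "set_integrable lebesgue S (\<lambda>z. (norm (f z))\<^sup>2) \<longleftrightarrow> integrable lborel (\<lambda>z. (norm (zero_ext S f z))\<^sup>2)"
    if "holomorphic2_on f S"
  proof -
    have [measurable]: "zero_ext S f \<in> borel_measurable borel"
      by (intro measurable_zero_ext holomorphic2_on_imp_continuous_on that assms)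
    have "(\<lambda>z. indicator S z *\<^sub>R (norm (f z))\<^sup>2) = (\<lambda>z. (norm (zero_ext S f z))\<^sup>2)"
      by (auto simp: zero_ext_def indicator_def)
    then show ?thesis
      by (simp add: set_integrable_def integrable_completion)
  qed
  then show ?thesis by (auto simp: bergman_space_def)
qed

lemma set_lebesgue_integral_zero_ext:
  assumes "open S" "continuous_on S f" "continuous_on S g"
  shows "set_lebesgue_integral lebesgue S (\<lambda>z. f z * cnj (g z)) = (\<integral>z. zero_ext S f z * cnj (zero_ext S g z) \<partial>lborel)"
proof -
  have [measurable]: "zero_ext S f \<in> borel_measurable borel" "zero_ext S g \<in> borel_measurable borel"
    by (intro measurable_zero_ext assms)+
  have "(\<lambda>z. indicator S z *\<^sub>R (f z * cnj (g z))) = (\<lambda>z. zero_ext S f z * cnj (zero_ext S g z))"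
    by (auto simp: zero_ext_def indicator_def)
  then show ?thesis
    by (simp add: set_lebesgue_integral_def integral_completion)
qed

lemma integrable_bergman_product:
  assumes "open S" "f \<in> bergman_space S" "g \<in> bergman_space S"
  shows "integrable lborel (\<lambda>z. zero_ext S f z * cnj (zero_ext S g z))"
proof (rule Bochner_Integration.integrable_bound)
  show "integrable lborel (\<lambda>z. (norm (zero_ext S f z))\<^sup>2 + (norm (zero_ext S g z))\<^sup>2)"
    using assms by (simp add: bergman_space_iff)
  have [measurable]: "zero_ext S f \<in> borel_measurable borel" "zero_ext S g \<in> borel_measurable borel"
    using assms by (auto intro!: measurable_zero_ext holomorphic2_on_imp_continuous_on simp: bergman_space_def)
  show "(\<lambda>z. zero_ext S f z * cnj (zero_ext S g z)) \<in> borel_measurable lborel" by measurable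
  have "x * y \<le> x\<^sup>2 + y\<^sup>2" if "x \<ge> 0" "y \<ge> 0" for x y :: real
    using that sum_squares_bound[of x y] mult_nonneg_nonneg[OF that] by linarith
  then show "AE z in lborel. norm (zero_ext S f z * cnj (zero_ext S g z)) \<le> norm ((norm (zero_ext S f z))\<^sup>2 + (norm (zero_ext S g z))\<^sup>2)"
    by (intro AE_I2) (simp add: norm_mult)
qed

subsection \<open>Laurent monomials on generalized Hartogs triangles\<close>

text \<open>The squared norm takes extended values, so that failure of square integrability is the
  value infinity.\<close>

definition lmono_nn_norm :: "real \<Rightarrow> int \<times> int \<Rightarrow> ennreal" where
  "lmono_nn_norm \<gamma> p = (\<integral>\<^sup>+z. ennreal ((norm (zero_ext (H_gamma \<gamma>) (lmono p) z))\<^sup>2) \<partial>lborel)"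

lemma norm_power_int_squared:
  fixes a :: complex
  assumes "a \<noteq> 0"
  shows "(norm (a powi m))\<^sup>2 = (norm a)\<^sup>2 powr of_int m"
proof -
  have "(norm (a powi m))\<^sup>2 = (norm a powr of_int m) powr 2"
    using assms by (simp add: norm_power_int powr_real_of_int')
  also have "\<dots> = ((norm a) powr 2) powr of_int m"
    using assms by (simp only: powr_powr mult.commute)
  finally show ?thesis using assms by simp
qed

text \<open>Rewrites the defining inequality of the domain in terms of the squared moduli, the
  variables in which area becomes length.\<close>

lemma powr_less_iff_squared:
  fixes \<gamma> x y :: real
  assumes "\<gamma> > 0" "x > 0" "y > 0"
  shows "x powr \<gamma> < y \<longleftrightarrow> x\<^sup>2 < y\<^sup>2 powr (1 / \<gamma>)"
proof -
  have "x powr \<gamma> < y \<longleftrightarrow> (x powr \<gamma>) powr (2 / \<gamma>) < y powr (2 / \<gamma>)"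
    using powr_less_mono2[of "2 / \<gamma>" "x powr \<gamma>" y] powr_mono2[of "2 / \<gamma>" y "x powr \<gamma>"] assms
    by (auto simp: not_less[symmetric])
  also have "(x powr \<gamma>) powr (2 / \<gamma>) = x\<^sup>2"
    using assms by (simp add: powr_powr)
  also have "y powr (2 / \<gamma>) = y\<^sup>2 powr (1 / \<gamma>)"
    using assms by (simp add: powr_powr flip: powr_numeral)
  finally show ?thesis .
qed

text \<open>In the variables x = |z_1|^2 and y = |z_2|^2 the squared norm is pi^2 times the integral
  of y^n x^m over 0 < x < y^(1/gamma), 0 < y < 1. The inner integral is finite only for m > -1 and
  then adds (m+1)/gamma to the exponent of y; the outer one needs the resulting exponent to exceed
  -1.\<close>

lemma lmono_nn_norm_eq:
  assumes "\<gamma> > 0"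
  shows "lmono_nn_norm \<gamma> (m, n) = (if m \<ge> 0 \<and> n + 1 + (m + 1) / \<gamma> > 0
     then ennreal (pi\<^sup>2 / ((m + 1) * (n + 1 + (m + 1) / \<gamma>))) else \<infinity>)"
proof -
  let ?H = "H_gamma \<gamma>"
  define k :: "real \<Rightarrow> ennreal" where "k y = ennreal (y powr n) * indicator {0<..<1} y" for y
  define h :: "real \<Rightarrow> real \<Rightarrow> ennreal" where
    "h y x = ennreal (x powr m) * indicator {0<..<y powr (1 / \<gamma>)} x" for y x
  define I :: "real \<Rightarrow> ennreal" where
    "I y = (if m \<ge> 0 then ennreal (y powr ((m + 1) / \<gamma>) / (m + 1)) else \<infinity>)" for y
  have [measurable]: "k \<in> borel_measurable borel" "\<And>y. h y \<in> borel_measurable borel" "I \<in> borel_measurable borel"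
    unfolding k_def h_def I_def by measurable
  have [measurable]: "zero_ext ?H (lmono (m, n)) \<in> borel_measurable borel"
    using open_H_gamma[OF assms]
    by (subst zero_ext_def[abs_def]) measurable
  \<comment> \<open>The points with a = 0 are excluded because \<open>h\<close> vanishes at 0,
    whereas a monomial with m = 0 does not. They form a null set.\<close>
  have pt: "ennreal ((norm (zero_ext ?H (lmono (m, n)) (a, b)))\<^sup>2) = k ((norm b)\<^sup>2) * h ((norm b)\<^sup>2) ((norm a)\<^sup>2)"
    if "a \<noteq> 0" for a b
  proof (cases "b = 0")
    case True
    then show ?thesis using that by (simp add: zero_ext_def H_gamma_def k_def)
  next
    case False
    have "(a, b) \<in> ?H \<longleftrightarrow> (norm a)\<^sup>2 < (norm b)\<^sup>2 powr (1 / \<gamma>) \<and> (norm b)\<^sup>2 < 1"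
      using that False assms by (simp add: H_gamma_def powr_less_iff_squared abs_square_less_1)
    then show ?thesis
      using that False
      by (auto simp: zero_ext_def k_def h_def lmono_def norm_mult power_mult_distrib
          norm_power_int_squared ennreal_mult indicator_def mult.commute)
  qed
  have inner: "(\<integral>\<^sup>+a. ennreal ((norm (zero_ext ?H (lmono (m, n)) (a, b)))\<^sup>2) \<partial>lborel)
      = ennreal pi * (k ((norm b)\<^sup>2) * I ((norm b)\<^sup>2))" for b
  proof (cases "0 < norm b \<and> norm b < 1")
    case True
    define y where "y = (norm b)\<^sup>2"
    have y: "0 < y" "y < 1" using True by (auto simp: y_def abs_square_less_1)
    have yp: "0 < y powr (1 / \<gamma>)" "y powr (1 / \<gamma>) \<le> 1"
      using y assms by (auto intro!: powr_le1)
    have "(\<integral>\<^sup>+x. h y x * indicator {0..} x \<partial>lborel) = (\<integral>\<^sup>+x. ennreal (x powr m) * indicator {0<..<y powr (1 / \<gamma>)} x \<partial>lborel)"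
      by (intro nn_integral_cong) (auto simp: h_def indicator_def)
    also have "\<dots> = I y"
      using y unfolding nn_integral_powr_less[OF yp] by (simp add: I_def powr_powr add_divide_distrib algebra_simps)
    finally have Iy: "(\<integral>\<^sup>+x. h y x * indicator {0..} x \<partial>lborel) = I y" .
    have "(\<integral>\<^sup>+a. ennreal ((norm (zero_ext ?H (lmono (m, n)) (a, b)))\<^sup>2) \<partial>lborel) = (\<integral>\<^sup>+a. k y * h y ((norm (a::complex))\<^sup>2) \<partial>lborel)"
      by (rule nn_integral_cong_AE) (use AE_lborel_singleton[of "0::complex"] in \<open>eventually_elim, simp add: pt y_def\<close>)
    also have "\<dots> = k y * (ennreal pi * I y)"
      by (simp add: nn_integral_cmult nn_integral_norm_power2_complex Iy)
    finally show ?thesis by (simp add: y_def mult_ac)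
  next
    case False
    then have "(a, b) \<notin> ?H" for a
      by (auto simp: H_gamma_def)
    moreover have "k ((norm b)\<^sup>2) = 0"
      using False by (auto simp: k_def indicator_def abs_square_less_1)
    ultimately show ?thesis by (simp add: zero_ext_def)
  qed
  have "lmono_nn_norm \<gamma> (m, n) = (\<integral>\<^sup>+z. ennreal ((norm (zero_ext ?H (lmono (m, n)) z))\<^sup>2) \<partial>(lborel \<Otimes>\<^sub>M lborel))"
    unfolding lmono_nn_norm_def lborel_prod ..
  also have "\<dots> = (\<integral>\<^sup>+b. (\<integral>\<^sup>+a. ennreal ((norm (zero_ext ?H (lmono (m, n)) (a, b)))\<^sup>2) \<partial>lborel) \<partial>lborel)"
    by (rule lborel_pair.nn_integral_snd[symmetric]) (simp add: lborel_prod)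
  also have "\<dots> = (\<integral>\<^sup>+b. ennreal pi * (k ((norm (b::complex))\<^sup>2) * I ((norm b)\<^sup>2)) \<partial>lborel)"
    unfolding inner ..
  also have "\<dots> = ennreal pi * (ennreal pi * (\<integral>\<^sup>+y. k y * I y * indicator {0..} y \<partial>lborel))"
    by (simp add: nn_integral_cmult nn_integral_norm_power2_complex[of "\<lambda>y. k y * I y"])
  also have "(\<integral>\<^sup>+y. k y * I y * indicator {0..} y \<partial>lborel) = (\<integral>\<^sup>+y. k y * I y \<partial>lborel)"
    by (intro nn_integral_cong) (auto simp: k_def indicator_def)
  also have "(\<integral>\<^sup>+y. k y * I y \<partial>lborel) = (if m \<ge> 0 \<and> n + 1 + (m + 1) / \<gamma> > 0
     then ennreal (1 / ((m + 1) * (n + 1 + (m + 1) / \<gamma>))) else \<infinity>)"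
  proof (cases "m \<ge> 0")
    case True
    have "(\<integral>\<^sup>+y. k y * I y \<partial>lborel) = (\<integral>\<^sup>+y. ennreal (1 / (m + 1)) * (ennreal (y powr (n + (m + 1) / \<gamma>)) * indicator {0<..<1} y) \<partial>lborel)"
      using True
      by (intro nn_integral_cong) (auto simp: k_def I_def indicator_def powr_add simp flip: ennreal_mult)
    also have "\<dots> = ennreal (1 / (m + 1)) * (\<integral>\<^sup>+y. ennreal (y powr (n + (m + 1) / \<gamma>)) * indicator {0<..<1} y \<partial>lborel)"
      by (rule nn_integral_cmult) measurable
    also have "(\<integral>\<^sup>+y. ennreal (y powr (n + (m + 1) / \<gamma>)) * indicator {0<..<1} y \<partial>lborel)
       = (if n + (m + 1) / \<gamma> > -1 then ennreal (1 / (n + 1 + (m + 1) / \<gamma>)) else \<infinity>)"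
      by (subst nn_integral_powr_less) (simp_all add: add_ac)
    finally show ?thesis
      using True by (auto simp: ennreal_mult_top simp flip: ennreal_mult)
  next
    case False
    \<comment> \<open>For m < 0 the inner integral is infinite for every y. In
      \<open>ennreal\<close> zero times infinity is zero, so the outer integral of \<open>k\<close>
      has to be shown nonzero.\<close>
    have "(\<integral>\<^sup>+y. k y * I y \<partial>lborel) = (\<integral>\<^sup>+y. k y \<partial>lborel) * \<infinity>"
      using False by (simp add: I_def nn_integral_multc)
    also have "(\<integral>\<^sup>+y. k y \<partial>lborel) \<noteq> 0"
      unfolding k_def by (subst nn_integral_powr_less) auto
    then have "(\<integral>\<^sup>+y. k y \<partial>lborel) * \<infinity> = \<infinity>" by (simp add: ennreal_mult_top)
    finally show ?thesis using False by simp
  qed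
  finally show ?thesis
    by (auto simp: ennreal_mult_top power2_eq_square simp flip: ennreal_mult)
qed

section \<open>Laurent coefficients on torus orbits\<close>

lemma lmono_tmul: "lmono p (tmul u z) = lmono p u * lmono p z"
  by (simp add: lmono_def tmul_def power_int_mult_distrib)

lemma lmono_minus: "lmono (- p) z = inverse (lmono p z)"
  by (simp add: lmono_def power_int_minus)

lemma lmono_neq_0: "z \<in> H_gamma \<gamma> \<Longrightarrow> fst z \<noteq> 0 \<Longrightarrow> lmono p z \<noteq> 0"
  using H_gamma_snd_neq_0[of z \<gamma>] by (simp add: lmono_def power_int_eq_0_iff)

lemma measurable_zero_ext_H_gamma:
  assumes "\<gamma> > 0" "holomorphic2_on f (H_gamma \<gamma>)"
  shows "zero_ext (H_gamma \<gamma>) f \<in> borel_measurable borel"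
  by (intro measurable_zero_ext holomorphic2_on_imp_continuous_on open_H_gamma assms)

lemma continuous_on_torus_orbit:
  assumes "holomorphic2_on f (H_gamma \<gamma>)" "z \<in> H_gamma \<gamma>"
  shows "continuous_on unit_torus (\<lambda>u. zero_ext (H_gamma \<gamma>) f (tmul u z))"
proof -
  have "continuous_on unit_torus (\<lambda>u. f (tmul u z))"
    by (rule continuous_on_compose2[OF holomorphic2_on_imp_continuous_on[OF assms(1)]])
       (use assms in \<open>auto simp: tmul_in_H_gamma_iff intro: continuous_on_subset[OF continuous_on_tmul]\<close>)
  then show ?thesis
    by (rule continuous_on_eq) (use assms in \<open>simp add: zero_ext_def tmul_in_H_gamma_iff\<close>)
qed

text \<open>Dividing f by the monomial reduces the claim to constancy of the orbit average
  \<open>T\<close> of the quotient. In each coordinate separately the quotient is holomorphic on an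
  annulus, punctured at 0 for the first coordinate, so its circle averages do not depend on the
  radius.\<close>

lemma laurent_coefficient_H_gamma:
  assumes \<gamma>: "\<gamma> > 0" and f: "holomorphic2_on f (H_gamma \<gamma>)"
  shows "\<exists>c. \<forall>z\<in>H_gamma \<gamma>. fst z \<noteq> 0 \<longrightarrow>
    (\<integral>u. zero_ext (H_gamma \<gamma>) f (tmul u z) * lmono (- p) u \<partial>torus_measure) = c * lmono p z"
proof -
  let ?H = "H_gamma \<gamma>"
  have [measurable]: "zero_ext ?H f \<in> borel_measurable borel"
    by (rule measurable_zero_ext_H_gamma[OF \<gamma> f])
  define F where "F z = zero_ext ?H f z * lmono (- p) z" for z
  have [measurable]: "F \<in> borel_measurable borel" unfolding F_def by measurable
  define T where "T z = (\<integral>u. F (tmul u z) \<partial>torus_measure)" for z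
  have int: "integrable torus_measure (\<lambda>u. F (tmul u z))" if "z \<in> ?H" "fst z \<noteq> 0" for z
  proof (rule integrable_torus)
    show "continuous_on unit_torus (\<lambda>u. F (tmul u z))"
      unfolding F_def lmono_tmul using that
      by (intro continuous_intros continuous_on_torus_orbit f)
  qed measurable
  have holF: "(\<lambda>a. F (a, b)) holomorphic_on {a. 0 < norm a \<and> norm a < norm b powr (1 / \<gamma>)}"
    "(\<lambda>b. F (a, b)) holomorphic_on {b. norm a powr \<gamma> < norm b \<and> norm b < 1}"
    if "0 < norm b" "norm b < 1" "a \<noteq> 0" for a b
  proof -
    have H: "(x, b) \<in> ?H" if "0 < norm x" "norm x < norm b powr (1 / \<gamma>)" for x
    proof -
      have "norm x powr \<gamma> < (norm b powr (1 / \<gamma>)) powr \<gamma>"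
        using that \<gamma> by (intro powr_less_mono2) auto
      then show ?thesis using \<gamma> \<open>0 < norm b\<close> \<open>norm b < 1\<close> by (simp add: H_gamma_def powr_powr)
    qed
    have "(\<lambda>a. f (a, b) * (a powi fst (- p) * b powi snd (- p))) holomorphic_on {a. 0 < norm a \<and> norm a < norm b powr (1 / \<gamma>)}"
      by (intro holomorphic_intros holomorphic_on_subset[OF holomorphic2_on_slices(1)[OF f]])
         (use H in auto)
    then show "(\<lambda>a. F (a, b)) holomorphic_on {a. 0 < norm a \<and> norm a < norm b powr (1 / \<gamma>)}"
      by (rule holomorphic_transform) (use H in \<open>simp add: F_def zero_ext_def lmono_def\<close>)
    have H': "(a, y) \<in> ?H" if "norm a powr \<gamma> < norm y" "norm y < 1" for y
      using that by (simp add: H_gamma_def)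
    have "(\<lambda>b. f (a, b) * (a powi fst (- p) * b powi snd (- p))) holomorphic_on {b. norm a powr \<gamma> < norm b \<and> norm b < 1}"
      by (intro holomorphic_intros holomorphic_on_subset[OF holomorphic2_on_slices(2)[OF f]])
         (use H' H_gamma_snd_neq_0[OF H'] in auto)
    then show "(\<lambda>b. F (a, b)) holomorphic_on {b. norm a powr \<gamma> < norm b \<and> norm b < 1}"
      by (rule holomorphic_transform) (use H' in \<open>simp add: F_def zero_ext_def lmono_def\<close>)
  qed
  have less_root: "norm a < norm b powr (1 / \<gamma>)" if "(a, b) \<in> ?H" for a b
  proof -
    have "(norm a powr \<gamma>) powr (1 / \<gamma>) < norm b powr (1 / \<gamma>)"
      using that \<gamma> by (intro powr_less_mono2) (auto simp: H_gamma_def)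
    then show ?thesis using \<gamma> by (simp add: powr_powr)
  qed
  have T1: "T (a, b) = T (a', b)" if "(a, b) \<in> ?H" "(a', b) \<in> ?H" "a \<noteq> 0" "a' \<noteq> 0" for a a' b
  proof -
    have b: "0 < norm b" "norm b < 1" using that H_gamma_snd_neq_0[OF that(1)] by (auto simp: H_gamma_def)
    have "(\<integral>u. F (u * a, v * b) \<partial>circle_measure) = (\<integral>u. F (u * a', v * b) \<partial>circle_measure)"
      if "norm v = 1" for v
    proof -
      have "(\<integral>u. F (a * u, v * b) \<partial>circle_measure) = (\<integral>u. F (a' * u, v * b) \<partial>circle_measure)"
        using holF(1)[of "v * b" 1] less_root[OF \<open>(a, b) \<in> ?H\<close>] less_root[OF \<open>(a', b) \<in> ?H\<close>]
          \<open>a \<noteq> 0\<close> \<open>a' \<noteq> 0\<close> b \<open>norm v = 1\<close>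
        by (intro integral_circle_measure_annulus[where r=0 and R="norm b powr (1 / \<gamma>)"])
           (auto simp: norm_mult)
      then show ?thesis by (simp add: mult.commute)
    qed
    then have "(\<integral>v. (\<integral>u. F (u * a, v * b) \<partial>circle_measure) \<partial>circle_measure)
        = (\<integral>v. (\<integral>u. F (u * a', v * b) \<partial>circle_measure) \<partial>circle_measure)"
      by (intro integral_cong_AE) (measurable, use AE_circle_norm in \<open>auto elim!: eventually_mono\<close>)
    then show ?thesis
      unfolding T_def using that
      by (simp add: integral_torus_iterated(1)[OF int]) (simp add: tmul_def)
  qed
  have T2: "T (a, b) = T (a, b')" if "(a, b) \<in> ?H" "(a, b') \<in> ?H" "a \<noteq> 0" for a b b'
  proof -
    have "(\<integral>v. F (u * a, v * b) \<partial>circle_measure) = (\<integral>v. F (u * a, v * b') \<partial>circle_measure)"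
      if "norm u = 1" for u
    proof -
      have "u \<noteq> 0" using that by auto
      have "(\<integral>v. F (u * a, b * v) \<partial>circle_measure) = (\<integral>v. F (u * a, b' * v) \<partial>circle_measure)"
        \<comment> \<open>The value 1/2 merely fills the slot of the outer second coordinate in
          \<open>holF\<close>; in its second statement that coordinate is a bound variable.\<close>
        using holF(2)[of "1/2" "u * a"] \<open>(a, b) \<in> ?H\<close> \<open>(a, b') \<in> ?H\<close> \<open>a \<noteq> 0\<close> \<open>norm u = 1\<close> \<open>u \<noteq> 0\<close>
        by (intro integral_circle_measure_annulus[where r="norm a powr \<gamma>" and R=1])
           (auto simp: norm_mult H_gamma_def)
      then show ?thesis by (simp add: mult.commute)
    qed
    then have "(\<integral>u. (\<integral>v. F (u * a, v * b) \<partial>circle_measure) \<partial>circle_measure)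
        = (\<integral>u. (\<integral>v. F (u * a, v * b') \<partial>circle_measure) \<partial>circle_measure)"
      by (intro integral_cong_AE) (measurable, use AE_circle_norm in \<open>auto elim!: eventually_mono\<close>)
    then show ?thesis
      unfolding T_def using that
      by (simp add: integral_torus_iterated(2)[OF int]) (simp add: tmul_def)
  qed
  text \<open>Shrinking $|a|$ keeps a point in the domain, so any two points are joined by moving one
    radius at a time.\<close>
  have T_le: "T (a, b) = T (a', b')"
    if "(a, b) \<in> ?H" "(a', b') \<in> ?H" "a \<noteq> 0" "a' \<noteq> 0" "norm a \<le> norm a'" for a b a' b'
  proof -
    have "norm a powr \<gamma> \<le> norm a' powr \<gamma>" using that \<gamma> by (intro powr_mono2) auto
    then have "(a, b') \<in> ?H" using that by (auto simp: H_gamma_def)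
    then show ?thesis using T1 T2 that by metis
  qed
  have "T z = T z'" if "z \<in> ?H" "z' \<in> ?H" "fst z \<noteq> 0" "fst z' \<noteq> 0" for z z'
    using T_le[of "fst z" "snd z" "fst z'" "snd z'"] T_le[of "fst z'" "snd z'" "fst z" "snd z"] that
    by (cases "norm (fst z) \<le> norm (fst z')") auto
  then obtain c where c: "\<And>z. z \<in> ?H \<Longrightarrow> fst z \<noteq> 0 \<Longrightarrow> T z = c"
    by metis
  have "(\<integral>u. zero_ext ?H f (tmul u z) * lmono (- p) u \<partial>torus_measure) = c * lmono p z"
    if "z \<in> ?H" "fst z \<noteq> 0" for z
  proof -
    have "T z = (\<integral>u. lmono (- p) z * (zero_ext ?H f (tmul u z) * lmono (- p) u) \<partial>torus_measure)"
      unfolding T_def F_def lmono_tmul by (simp add: mult_ac)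
    also have "\<dots> = lmono (- p) z * (\<integral>u. zero_ext ?H f (tmul u z) * lmono (- p) u \<partial>torus_measure)"
      by simp
    finally show ?thesis
      using c[OF that] lmono_neq_0[OF that, of p] by (simp add: lmono_minus field_simps)
  qed
  then show ?thesis by blast
qed

subsection \<open>The orthogonal expansion of the kernel\<close>

lemma (in prob_space) square_expectation_le:
  fixes X :: "'a \<Rightarrow> real"
  assumes "integrable M X" "integrable M (\<lambda>x. (X x)\<^sup>2)"
  shows "(expectation X)\<^sup>2 \<le> expectation (\<lambda>x. (X x)\<^sup>2)"
  using variance_positive[of X] variance_eq[OF assms] by simp

text \<open>Bessel's inequality on each torus orbit gives $|c|^2 |z^p|^2 \le$ the average of $|f|^2$ over
  the orbit of $z$.\<close>
lemma laurent_coefficient_eq_0: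
  assumes \<gamma>: "\<gamma> > 0" and f: "f \<in> bergman_space (H_gamma \<gamma>)" and inf: "lmono_nn_norm \<gamma> p = \<infinity>"
    and c: "\<And>z. z \<in> H_gamma \<gamma> \<Longrightarrow> fst z \<noteq> 0 \<Longrightarrow>
      (\<integral>u. zero_ext (H_gamma \<gamma>) f (tmul u z) * lmono (- p) u \<partial>torus_measure) = c * lmono p z"
  shows "c = 0"
proof (rule ccontr)
  assume "c \<noteq> 0"
  let ?H = "H_gamma \<gamma>" and ?f = "zero_ext (H_gamma \<gamma>) f"
  have hol: "holomorphic2_on f ?H" and int: "integrable lborel (\<lambda>z. (norm (?f z))\<^sup>2)"
    using f by (simp_all add: bergman_space_iff open_H_gamma \<gamma>)
  have [measurable]: "?f \<in> borel_measurable borel"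
    by (rule measurable_zero_ext_H_gamma[OF \<gamma> hol])
  have [measurable]: "zero_ext ?H (lmono p) \<in> borel_measurable borel"
    using open_H_gamma[OF \<gamma>] by (subst zero_ext_def[abs_def]) measurable
  have le: "ennreal ((norm c)\<^sup>2) * ennreal ((norm (zero_ext ?H (lmono p) z))\<^sup>2) \<le>
      (\<integral>\<^sup>+u. ennreal ((norm (?f (tmul u z)))\<^sup>2) \<partial>torus_measure)" if "fst z \<noteq> 0" for z
  proof (cases "z \<in> ?H")
    case True
    note cont = continuous_on_torus_orbit[OF hol True]
    have i1: "integrable torus_measure (\<lambda>u. norm (?f (tmul u z)))"
      by (rule integrable_torus) (measurable, intro continuous_intros cont)
    have i2: "integrable torus_measure (\<lambda>u. (norm (?f (tmul u z)))\<^sup>2)"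
      by (rule integrable_torus) (measurable, intro continuous_intros cont)
    have "norm c * norm (lmono p z) = norm (\<integral>u. ?f (tmul u z) * lmono (- p) u \<partial>torus_measure)"
      by (simp add: c[OF True that] norm_mult)
    also have "\<dots> \<le> (\<integral>u. norm (?f (tmul u z) * lmono (- p) u) \<partial>torus_measure)"
      by (rule integral_norm_bound)
    also have "\<dots> = (\<integral>u. norm (?f (tmul u z)) \<partial>torus_measure)"
    proof (rule integral_cong_AE)
      show "AE u in torus_measure. norm (?f (tmul u z) * lmono (- p) u) = norm (?f (tmul u z))"
        using AE_torus by eventually_elim (simp add: norm_mult norm_lmono_torus)
    qed measurable
    finally have "(norm c * norm (lmono p z))\<^sup>2 \<le> (\<integral>u. norm (?f (tmul u z)) \<partial>torus_measure)\<^sup>2"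
      by (intro power_mono) auto
    also have "\<dots> \<le> (\<integral>u. (norm (?f (tmul u z)))\<^sup>2 \<partial>torus_measure)"
      by (rule torus.square_expectation_le[OF i1 i2])
    finally have "(norm c * norm (lmono p z))\<^sup>2 \<le> (\<integral>u. (norm (?f (tmul u z)))\<^sup>2 \<partial>torus_measure)" .
    then show ?thesis
      using nn_integral_eq_integral[OF i2] True
      by (simp add: zero_ext_def power_mult_distrib ennreal_leI flip: ennreal_mult)
  qed (simp add: zero_ext_def)
  \<comment> \<open>Integrating the orbit inequality bounds |c|^2 times the infinite norm of the
    monomial by the finite squared norm of f.\<close>
  have "ennreal ((norm c)\<^sup>2) * lmono_nn_norm \<gamma> p =
      (\<integral>\<^sup>+z. ennreal ((norm c)\<^sup>2) * ennreal ((norm (zero_ext ?H (lmono p) z))\<^sup>2) \<partial>lborel)"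
    unfolding lmono_nn_norm_def by (rule nn_integral_cmult[symmetric]) measurable
  also have "\<dots> \<le> (\<integral>\<^sup>+z. (\<integral>\<^sup>+u. ennreal ((norm (?f (tmul u z)))\<^sup>2) \<partial>torus_measure) \<partial>lborel)"
    by (rule nn_integral_mono_AE) (use AE_lborel_fst_neq_0 le in \<open>auto elim!: eventually_mono\<close>)
  also have "\<dots> = (\<integral>\<^sup>+z. ennreal ((norm (?f z))\<^sup>2) \<partial>lborel)"
    by (rule nn_integral_lborel_torus_average) measurable
  also have "\<dots> < \<infinity>"
    using int by (simp add: integrable_iff_bounded)
  finally show False
    using inf \<open>c \<noteq> 0\<close> by (simp add: ennreal_mult_top)
qed

text \<open>Averaging the integrand over the orbit of z isolates one Fourier coefficient of f and
  leaves the conjugate of c times the squared modulus of the monomial. This plays the part of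
  orthogonality.\<close>

lemma integral_lmono_cnj:
  assumes \<gamma>: "\<gamma> > 0" and f: "f \<in> bergman_space (H_gamma \<gamma>)"
    and p: "lmono p \<in> bergman_space (H_gamma \<gamma>)"
    and c: "\<And>z. z \<in> H_gamma \<gamma> \<Longrightarrow> fst z \<noteq> 0 \<Longrightarrow>
      (\<integral>u. zero_ext (H_gamma \<gamma>) f (tmul u z) * lmono (- p) u \<partial>torus_measure) = c * lmono p z"
  shows "(\<integral>z. zero_ext (H_gamma \<gamma>) (lmono p) z * cnj (zero_ext (H_gamma \<gamma>) f z) \<partial>lborel)
     = cnj c * of_real (enn2real (lmono_nn_norm \<gamma> p))"
proof -
  let ?H = "H_gamma \<gamma>" and ?f = "zero_ext (H_gamma \<gamma>) f" and ?e = "zero_ext (H_gamma \<gamma>) (lmono p)"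
  have hol: "holomorphic2_on f ?H"
    using f by (simp add: bergman_space_iff open_H_gamma \<gamma>)
  have [measurable]: "?f \<in> borel_measurable borel" "?e \<in> borel_measurable borel"
    using f p by (auto intro!: measurable_zero_ext_H_gamma[OF \<gamma>] simp: bergman_space_iff open_H_gamma \<gamma>)
  have inner: "(\<integral>u. ?e (tmul u z) * cnj (?f (tmul u z)) \<partial>torus_measure) = cnj c * of_real ((norm (?e z))\<^sup>2)"
    if z0: "fst z \<noteq> 0" for z
  proof (cases "z \<in> ?H")
    case True
    have "(\<integral>u. ?e (tmul u z) * cnj (?f (tmul u z)) \<partial>torus_measure) =
        (\<integral>u. lmono p z * cnj (?f (tmul u z) * lmono (- p) u) \<partial>torus_measure)"
    proof (rule integral_cong_AE)
      show "AE u in torus_measure. ?e (tmul u z) * cnj (?f (tmul u z)) = lmono p z * cnj (?f (tmul u z) * lmono (- p) u)"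
        using AE_torus
      proof eventually_elim
        case (elim u)
        have "lmono p u * cnj (lmono p u) = 1"
          using norm_lmono_torus[OF elim, of p] by (simp flip: complex_norm_square)
        then have "cnj (lmono (- p) u) = lmono p u"
          unfolding lmono_minus by (metis complex_cnj_inverse inverse_unique mult.commute inverse_inverse_eq)
        then show ?case
          using elim True by (simp add: zero_ext_def tmul_in_H_gamma_iff lmono_tmul mult_ac)
      qed
    qed measurable
    also have "\<dots> = lmono p z * (\<integral>u. cnj (?f (tmul u z) * lmono (- p) u) \<partial>torus_measure)"
      by (rule integral_mult_right_zero)
    also have "\<dots> = lmono p z * cnj (\<integral>u. ?f (tmul u z) * lmono (- p) u \<partial>torus_measure)"
      by (simp only: Bochner_Integration.integral_cnj)
    also have "\<dots> = cnj c * (lmono p z * cnj (lmono p z))"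
      by (simp add: c[OF True z0])
    also have "\<dots> = cnj c * of_real ((norm (?e z))\<^sup>2)"
      using True by (simp add: zero_ext_def complex_norm_square del: of_real_power)
    finally show ?thesis .
  next
    case False
    have "(\<integral>u. ?e (tmul u z) * cnj (?f (tmul u z)) \<partial>torus_measure) = (\<integral>u. 0 \<partial>torus_measure)"
    proof (rule integral_cong_AE)
      show "AE u in torus_measure. ?e (tmul u z) * cnj (?f (tmul u z)) = 0"
        using AE_torus by eventually_elim (use False in \<open>simp add: zero_ext_def tmul_in_H_gamma_iff\<close>)
    qed measurable
    then show ?thesis using False by (simp add: zero_ext_def)
  qed
  have "(\<integral>z. ?e z * cnj (?f z) \<partial>lborel) = (\<integral>z. (\<integral>u. ?e (tmul u z) * cnj (?f (tmul u z)) \<partial>torus_measure) \<partial>lborel)"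
    by (rule integral_lborel_torus_average[symmetric])
       (intro integrable_bergman_product open_H_gamma \<gamma> f p)
  also have "\<dots> = (\<integral>z. cnj c * of_real ((norm (?e z))\<^sup>2) \<partial>lborel)"
    by (rule integral_cong_AE) (measurable, use AE_lborel_fst_neq_0 inner in \<open>auto elim!: eventually_mono\<close>)
  also have "\<dots> = cnj c * of_real (\<integral>z. (norm (?e z))\<^sup>2 \<partial>lborel)"
    by (simp del: of_real_power)
  also have "(\<integral>z. (norm (?e z))\<^sup>2 \<partial>lborel) = enn2real (lmono_nn_norm \<gamma> p)"
    unfolding lmono_nn_norm_def by (rule integral_eq_nn_integral) auto
  finally show ?thesis .
qed

text \<open>A finite norm forces m >= 0, so the monomial is differentiable also where z_1 = 0; the
  second coordinate never vanishes on the domain.\<close>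

lemma lmono_in_bergman_space:
  assumes \<gamma>: "\<gamma> > 0" and "lmono_nn_norm \<gamma> (m, n) \<noteq> \<infinity>"
  shows "lmono (m, n) \<in> bergman_space (H_gamma \<gamma>)"
proof -
  have "m \<ge> 0" using assms lmono_nn_norm_eq[OF \<gamma>, of m n] by (auto split: if_splits)
  have "x powi m = x ^ nat m" for x :: complex
    using \<open>m \<ge> 0\<close> by (simp add: power_int_def)
  then have lm: "lmono (m, n) = (\<lambda>z. fst z ^ nat m * snd z powi n)"
    by (simp add: lmono_def[abs_def])
  have hol: "holomorphic2_on (lmono (m, n)) (H_gamma \<gamma>)"
    unfolding holomorphic2_on_def
  proof (intro ballI exI)
    fix z assume "z \<in> H_gamma \<gamma>"
    then have "snd z \<noteq> 0" by (rule H_gamma_snd_neq_0)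
    then have "((\<lambda>z. fst z ^ nat m * snd z powi n) has_derivative
      (\<lambda>h. (of_nat (nat m) * fst z ^ (nat m - 1) * snd z powi n) * fst h
         + (fst z ^ nat m * (of_int n * snd z powi (n - 1))) * snd h)) (at z)"
      by (auto intro!: derivative_eq_intros simp: algebra_simps)
    then show "(lmono (m, n) has_derivative
      (\<lambda>h. (of_nat (nat m) * fst z ^ (nat m - 1) * snd z powi n) * fst h
         + (fst z ^ nat m * (of_int n * snd z powi (n - 1))) * snd h)) (at z)"
      unfolding lm .
  qed
  have "zero_ext (H_gamma \<gamma>) (lmono (m, n)) \<in> borel_measurable borel"
    by (rule measurable_zero_ext_H_gamma[OF \<gamma> hol])
  then have "integrable lborel (\<lambda>z. (norm (zero_ext (H_gamma \<gamma>) (lmono (m, n)) z))\<^sup>2)"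
    using assms(2) by (simp add: integrable_iff_bounded lmono_nn_norm_def less_top)
  then show ?thesis
    using hol by (simp add: bergman_space_iff open_H_gamma \<gamma>)
qed

text \<open>The real factor is the reciprocal of the squared norm, so each term is a normalized
  monomial at z times its conjugate at w.\<close>

definition kernel_term :: "real \<Rightarrow> complex \<times> complex \<Rightarrow> complex \<times> complex \<Rightarrow> int \<times> int \<Rightarrow> complex" where
  "kernel_term \<gamma> z w = (\<lambda>(m, n). if m \<ge> 0 \<and> n + 1 + (m + 1) / \<gamma> > 0
     then of_real ((m + 1) * (n + 1 + (m + 1) / \<gamma>) / pi\<^sup>2) * lmono (m, n) z * cnj (lmono (m, n) w) else 0)"

text \<open>The terms are shown to be the Fourier coefficients of the torus orbit of z under K(.,
  w), and the Fourier series is evaluated at the identity of the torus. Absolute summability is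
  assumed at the given pair and is verified later at the concrete points.\<close>

lemma kernel_eq_infsum:
  assumes \<gamma>: "\<gamma> > 0" and K: "is_bergman_kernel (H_gamma \<gamma>) K"
    and z: "z \<in> H_gamma \<gamma>" "fst z \<noteq> 0" and w: "w \<in> H_gamma \<gamma>"
    and summ: "(\<lambda>p. norm (kernel_term \<gamma> z w p)) summable_on UNIV"
  shows "K z w = (\<Sum>\<^sub>\<infinity>p. kernel_term \<gamma> z w p)"
proof -
  let ?H = "H_gamma \<gamma>"
  define f where "f = (\<lambda>z. K z w)"
  have f: "f \<in> bergman_space ?H"
    using K w by (simp add: is_bergman_kernel_def f_def)
  have rep: "g w = (\<integral>z. zero_ext ?H g z * cnj (zero_ext ?H f z) \<partial>lborel)" if "g \<in> bergman_space ?H" for g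
  proof -
    have "g w = set_lebesgue_integral lebesgue ?H (\<lambda>z. g z * cnj (f z))"
      using K w that by (simp add: is_bergman_kernel_def f_def)
    also have "\<dots> = (\<integral>z. zero_ext ?H g z * cnj (zero_ext ?H f z) \<partial>lborel)"
      using f that
      by (intro set_lebesgue_integral_zero_ext open_H_gamma \<gamma> holomorphic2_on_imp_continuous_on)
         (simp_all add: bergman_space_def)
    finally show ?thesis .
  qed
  have hol: "holomorphic2_on f ?H" using f by (simp add: bergman_space_def)
  have [measurable]: "zero_ext ?H f \<in> borel_measurable borel"
    by (rule measurable_zero_ext_H_gamma[OF \<gamma> hol])
  have coeff: "(\<integral>u. zero_ext ?H f (tmul u z) * lmono (- p) u \<partial>torus_measure) = kernel_term \<gamma> z w p" for p
  proof -
    obtain m n where p: "p = (m, n)" by (cases p)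
    obtain c where c: "\<And>z. z \<in> ?H \<Longrightarrow> fst z \<noteq> 0 \<Longrightarrow>
      (\<integral>u. zero_ext ?H f (tmul u z) * lmono (- p) u \<partial>torus_measure) = c * lmono p z"
      using laurent_coefficient_H_gamma[OF \<gamma> hol, of p] by blast
    show ?thesis
    proof (cases "m \<ge> 0 \<and> n + 1 + (m + 1) / \<gamma> > 0")
      case True
      define N where "N = pi\<^sup>2 / ((m + 1) * (n + 1 + (m + 1) / \<gamma>))"
      have N: "N > 0" using True by (simp add: N_def)
      have norm_eq: "lmono_nn_norm \<gamma> p = ennreal N"
        unfolding p N_def using True by (subst lmono_nn_norm_eq[OF \<gamma>]) simp
      then have "lmono p \<in> bergman_space ?H"
        unfolding p by (intro lmono_in_bergman_space \<gamma>) simp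
      \<comment> \<open>The reproducing formula for the monomial evaluates it at w, while the orbit
        average evaluates the same integral as the conjugate of c times the squared norm; this
        determines c.\<close>
      then have "lmono p w = cnj c * of_real N"
        using rep[of "lmono p"] integral_lmono_cnj[OF \<gamma> f _ c] N by (simp add: norm_eq)
      then have "cnj (lmono p w) = c * of_real N"
        by (metis complex_cnj_cnj complex_cnj_complex_of_real complex_cnj_mult)
      then have "c = of_real (inverse N) * cnj (lmono p w)"
        using N by (simp add: field_simps)
      then show ?thesis
        unfolding c[OF z] using True by (simp add: p kernel_term_def N_def mult_ac)
    next
      case False
      then have "lmono_nn_norm \<gamma> p = \<infinity>"
        unfolding p by (subst lmono_nn_norm_eq[OF \<gamma>]) simp
      then have "c = 0" by (rule laurent_coefficient_eq_0[OF \<gamma> f _ c])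
      have "kernel_term \<gamma> z w p = 0" using False by (auto simp: p kernel_term_def)
      then show ?thesis by (simp add: c[OF z] \<open>c = 0\<close>)
    qed
  qed
  have one: "(1, 1) \<in> unit_torus" by (simp add: in_unit_torus_iff)
  have "zero_ext ?H f (tmul (1, 1) z) = (\<Sum>\<^sub>\<infinity>p. kernel_term \<gamma> z w p * lmono p (1, 1))"
    by (rule fourier_series_torus[OF _ continuous_on_torus_orbit[OF hol z(1)] coeff summ one]) measurable
  then show ?thesis using z by (simp add: tmul_def zero_ext_def lmono_def f_def)
qed

subsection \<open>Zeros of the kernel\<close>

text \<open>Reduces a zero of the kernel to summing one complex family, once the indices of the
  nonzero terms are parametrized by \<open>h\<close>.\<close>

lemma kernel_eq_0I:
  fixes h :: "'i \<Rightarrow> int \<times> int"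
  assumes \<gamma>: "\<gamma> > 0" and K: "is_bergman_kernel (H_gamma \<gamma>) K"
    and z: "z \<in> H_gamma \<gamma>" "fst z \<noteq> 0" and w: "w \<in> H_gamma \<gamma>"
    and inj: "inj_on h I" and off: "\<And>p. p \<notin> h ` I \<Longrightarrow> kernel_term \<gamma> z w p = 0"
    and summ: "(\<lambda>i. norm (kernel_term \<gamma> z w (h i))) summable_on I"
    and sum: "((\<lambda>i. kernel_term \<gamma> z w (h i)) has_sum 0) I"
  shows "K z w = 0"
proof -
  have "(\<lambda>p. norm (kernel_term \<gamma> z w p)) summable_on (h ` I)"
    using summ by (simp add: summable_on_reindex[OF inj] o_def)
  then have "(\<lambda>p. norm (kernel_term \<gamma> z w p)) summable_on UNIV"
    by (subst summable_on_cong_neutral[where T="h ` I"]) (auto simp: off)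
  then have "K z w = (\<Sum>\<^sub>\<infinity>p. kernel_term \<gamma> z w p)"
    by (rule kernel_eq_infsum[OF \<gamma> K z w])
  also have "\<dots> = infsum (kernel_term \<gamma> z w) (h ` I)"
    by (rule infsum_cong_neutral) (auto simp: off)
  also have "\<dots> = 0"
    using infsumI[OF sum] by (simp add: infsum_reindex[OF inj] o_def)
  finally show ?thesis .
qed

lemma has_sum_geometric_deriv:
  fixes x :: complex
  assumes "norm x < 1"
  shows "((\<lambda>n. of_nat (Suc n) * x ^ n) has_sum (1 / (1 - x)\<^sup>2)) UNIV"
    and "(\<lambda>n. norm (of_nat (Suc n) * x ^ n)) summable_on UNIV"
proof -
  have eq: "norm (of_nat (Suc n) * x ^ n) = of_nat (Suc n) * norm x ^ n" for n
    by (simp only: norm_mult norm_of_nat norm_power)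
  have s: "summable (\<lambda>n. norm (of_nat (Suc n) * x ^ n))"
    unfolding eq using geometric_deriv_sums[of "norm x"] assms by (auto simp: sums_iff)
  show "((\<lambda>n. of_nat (Suc n) * x ^ n) has_sum (1 / (1 - x)\<^sup>2)) UNIV"
    by (rule norm_summable_imp_has_sum[OF s geometric_deriv_sums[OF assms]])
  show "(\<lambda>n. norm (of_nat (Suc n) * x ^ n)) summable_on UNIV"
    using s by (rule summable_nonneg_imp_summable_on) simp
qed

lemma has_sum_product:
  fixes a b :: "'i \<Rightarrow> complex"
  assumes "(a has_sum A) S" "(b has_sum B) T"
    and na: "(\<lambda>i. norm (a i)) summable_on S" and nb: "(\<lambda>j. norm (b j)) summable_on T"
  shows "((\<lambda>(i, j). a i * b j) has_sum (A * B)) (S \<times> T)"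
    and "(\<lambda>(i, j). norm (a i * b j)) summable_on (S \<times> T)"
proof -
  have "(\<lambda>p. norm ((\<lambda>(i, j). a i * b j) p)) summable_on (S \<times> T)"
  proof (rule Infinite_Sum.abs_summable_on_Sigma_iff[THEN iffD2], intro conjI ballI)
    show "(\<lambda>j. norm ((\<lambda>(i, j). a i * b j) (i, j))) summable_on T" for i
      by (simp add: norm_mult summable_on_cmult_right nb)
    show "(\<lambda>i. norm (\<Sum>\<^sub>\<infinity>j\<in>T. norm ((\<lambda>(i, j). a i * b j) (i, j)))) summable_on S"
      by (simp add: norm_mult infsum_cmult_right' abs_mult summable_on_cmult_left na)
  qed
  note abs = this
  then show "(\<lambda>(i, j). norm (a i * b j)) summable_on (S \<times> T)"
    by (simp add: case_prod_unfold)
  have "(\<lambda>(i, j). a i * b j) summable_on (S \<times> T)"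
    using abs by (rule abs_summable_summable)
  then show "((\<lambda>(i, j). a i * b j) has_sum (A * B)) (S \<times> T)"
    by (rule has_sum_SigmaI[rotated 2, where g="\<lambda>i. a i * B"])
       (auto intro!: has_sum_cmult_right has_sum_cmult_left assms)
qed

lemma kernel_zero_gt_2:
  assumes \<gamma>: "\<gamma> > 2" and K: "is_bergman_kernel (H_gamma \<gamma>) K"
  shows "\<exists>z\<in>H_gamma \<gamma>. \<exists>w\<in>H_gamma \<gamma>. K z w = 0"
proof -
  \<comment> \<open>Chosen so that the product of z_2 and the conjugate of w_2 is -r^2 =
    -1/(gamma-1). The assumption gamma > 2 is what makes r < 1; the first coordinate of z only has
    to be nonzero and small enough for the domain.\<close>
  define r where "r = sqrt (1 / (\<gamma> - 1))"
  have r: "0 < r" "r < 1" using \<gamma> by (auto simp: r_def)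
  have r2: "r\<^sup>2 = 1 / (\<gamma> - 1)" using \<gamma> by (simp add: r_def)
  define z w :: "complex \<times> complex" where "z = (of_real r, - of_real r)" and "w = (0, of_real r)"
  have "r powr \<gamma> < r powr 1" using r \<gamma> by (intro powr_less_mono') auto
  then have zw: "z \<in> H_gamma \<gamma>" "fst z \<noteq> 0" "w \<in> H_gamma \<gamma>"
    using r \<gamma> by (auto simp: z_def w_def H_gamma_def)
  define t :: complex where "t = - of_real (r\<^sup>2)"
  have t: "norm t < 1" "t \<noteq> 0"
    using r by (auto simp: t_def abs_square_less_1 norm_power simp flip: of_real_power)
  define h :: "nat \<Rightarrow> int \<times> int" where "h k = (0, int k - 1)" for k
  define C where "C = 1 / (of_real pi ^ 2 * t)"
  \<comment> \<open>With k = n + 1 the weight k + 1/gamma is split as (k+1) + (1/gamma - 1), giving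
    a differentiated and a plain geometric series. The shift puts 1/t into \<open>C\<close>.\<close>
  have term_eq: "kernel_term \<gamma> z w (h k) = C * (of_nat (Suc k) * t ^ k + (1 / of_real \<gamma> - 1) * t ^ k)" for k
  proof -
    have "kernel_term \<gamma> z w (h k) = of_real ((k + 1 / \<gamma>) / pi\<^sup>2) *
        ((- of_real r) powi (int k - 1) * of_real r powi (int k - 1))"
      using \<gamma> by (auto simp: kernel_term_def h_def lmono_def z_def w_def power_int_mult_distrib add_nonneg_pos
          simp flip: of_real_power_int)
    also have "(- of_real r) powi (int k - 1) * (of_real r :: complex) powi (int k - 1) = t powi (int k - 1)"
      by (simp add: t_def power2_eq_square flip: power_int_mult_distrib)
    also have "\<dots> = t ^ k / t"
      using t by (simp add: power_int_diff)
    finally show ?thesis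
      using t \<gamma> by (simp add: C_def field_simps)
  qed
  have s1: "((\<lambda>k. t ^ k) has_sum (1 / (1 - t))) UNIV" "(\<lambda>k. norm (t ^ k)) summable_on UNIV"
    using t by (auto intro!: norm_summable_imp_has_sum geometric_sums summable_nonneg_imp_summable_on
        simp: norm_power)
  note s2 = has_sum_geometric_deriv[OF t(1)]
  have "((\<lambda>k. C * (of_nat (Suc k) * t ^ k + (1 / of_real \<gamma> - 1) * t ^ k)) has_sum
      (C * (1 / (1 - t)\<^sup>2 + (1 / of_real \<gamma> - 1) * (1 / (1 - t))))) UNIV"
    by (intro has_sum_cmult_right has_sum_add s1 s2)
  also have "C * (1 / (1 - t)\<^sup>2 + (1 / of_real \<gamma> - 1) * (1 / (1 - t))) = 0"
  proof -
    \<comment> \<open>Here 1 + r^2 = 1 - t = gamma/(gamma-1), so the second summand of the bracket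
      is minus the square of 1/(1-t).\<close>
    have "1 / \<gamma> - 1 = - 1 / (1 + r\<^sup>2)" using \<gamma> unfolding r2 by (simp add: divide_simps)
    then have "1 / (1 + r\<^sup>2)\<^sup>2 + (1 / \<gamma> - 1) * (1 / (1 + r\<^sup>2)) = 0"
      by (simp add: power2_eq_square)
    then have "of_real (1 / (1 + r\<^sup>2)\<^sup>2 + (1 / \<gamma> - 1) * (1 / (1 + r\<^sup>2))) = (0 :: complex)"
      by (simp only: of_real_0)
    moreover have t1: "1 - t = of_real (1 + r\<^sup>2)" by (simp add: t_def)
    ultimately show ?thesis unfolding t1 by simp
  qed
  finally have sum: "((\<lambda>k. kernel_term \<gamma> z w (h k)) has_sum 0) UNIV" by (simp only: term_eq)
  have "(\<lambda>k. norm (kernel_term \<gamma> z w (h k))) summable_on UNIV"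
  proof (rule Infinite_Sum.abs_summable_on_comparison_test')
    show "(\<lambda>k. norm C * (norm (of_nat (Suc k) * t ^ k) + norm (1 / of_real \<gamma> - 1 :: complex) * norm (t ^ k))) summable_on UNIV"
      by (intro summable_on_cmult_right summable_on_add s1 s2)
    show "norm (kernel_term \<gamma> z w (h k)) \<le>
        norm C * (norm (of_nat (Suc k) * t ^ k) + norm (1 / of_real \<gamma> - 1 :: complex) * norm (t ^ k))" for k
      unfolding term_eq norm_mult[of C]
      by (intro mult_left_mono order_trans[OF norm_triangle_ineq]) (auto simp: norm_mult)
  qed
  moreover have "kernel_term \<gamma> z w p = 0" if p: "p \<notin> range h" for p
  proof (rule ccontr)
    assume nz: "kernel_term \<gamma> z w p \<noteq> 0"
    obtain m n where mn: "p = (m, n)" by (cases p)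
    have cond: "m \<ge> 0" "n + 1 + (m + 1) / \<gamma> > 0" and "lmono (m, n) w \<noteq> 0"
      using nz by (auto simp: kernel_term_def mn split: if_splits)
    \<comment> \<open>As w_1 = 0, the power \<open>0 powi m\<close> is 0 for every m other than 0,
      negative ones included, and 1 for m = 0.\<close>
    then have "m = 0" by (auto simp: lmono_def w_def split: if_splits)
    moreover have "1 / \<gamma> < 1" using \<gamma> by simp
    \<comment> \<open>Now n > -2, so n + 1 is a natural number and the index lies in the range of
      \<open>h\<close>.\<close>
    ultimately have "real_of_int n + 1 > - 1"
      using cond(2) by simp
    then have "p = h (nat (n + 1))" using \<open>m = 0\<close> by (simp add: mn h_def)
    then show False using p by blast
  qed
  ultimately have "K z w = 0"
    by (intro kernel_eq_0I[OF _ K zw _ _ _ sum]) (use \<gamma> in \<open>auto simp: inj_on_def h_def\<close>)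
  then show ?thesis using zw by blast
qed

lemma kernel_zero_eq_2:
  assumes K: "is_bergman_kernel (H_gamma 2) K"
  shows "\<exists>z\<in>H_gamma 2. \<exists>w\<in>H_gamma 2. K z w = 0"
proof -
  define r where "r = sqrt 2 - 1"
  have r: "0 < r" "r < 1"
    using real_sqrt_less_iff[of 1 2] real_sqrt_less_iff[of 2 4] by (auto simp: r_def simp del: real_sqrt_less_iff)
  have r4: "r ^ 4 = 6 * r\<^sup>2 - 1"
  proof -
    have 1: "r\<^sup>2 = 3 - 2 * sqrt 2" by (simp add: r_def power2_eq_square algebra_simps)
    have "r ^ 4 = (r\<^sup>2)\<^sup>2" by simp
    then show ?thesis unfolding 1 by (simp add: power2_eq_square algebra_simps)
  qed
  \<comment> \<open>Both coordinate products s and t equal -r^2, which is the square of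
    \<open>\<tau>\<close>; this is the case sigma = tau.\<close>
  define z w :: "complex \<times> complex" where "z = (- of_real r, - of_real r)" and "w = (of_real r, of_real r)"
  have "r\<^sup>2 < r" using r by (simp add: power2_eq_square)
  then have zw: "z \<in> H_gamma 2" "fst z \<noteq> 0" "w \<in> H_gamma 2"
    using r by (auto simp: z_def w_def H_gamma_def)
  define \<tau> :: complex where "\<tau> = \<i> * of_real r"
  have \<tau>: "norm \<tau> < 1" "norm (- \<tau>) < 1" "\<tau> \<noteq> 0" using r by (auto simp: \<tau>_def norm_mult)
  define a :: "complex \<Rightarrow> nat \<Rightarrow> complex" where "a x n = of_nat (Suc n) * x ^ n" for x n
  define C where "C = 1 / (2 * of_real pi ^ 2 * \<tau>\<^sup>2)"
  define I :: "(nat \<times> nat) set" where "I = {(i, j). even (i + j)}"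
  \<comment> \<open>Inverse of the substitution i = m, j = 2n + m + 2. On \<open>I\<close> the
    division by 2 is exact, and the condition for square integrability has become j + 1 > 0.\<close>
  define h :: "nat \<times> nat \<Rightarrow> int \<times> int" where "h = (\<lambda>(i, j). (int i, (int j - int i - 2) div 2))"
  have half: "2 * ((int j - int i - 2) div 2) = int j - int i - 2" if "even (i + j)" for i j :: nat
    using that by presburger
  have inj: "inj_on h I"
  proof (rule inj_onI)
    fix p q assume pq: "p \<in> I" "q \<in> I" "h p = h q"
    obtain i j i' j' where ij: "p = (i, j)" "q = (i', j')" by (cases p, cases q)
    have "i = i'" using pq(3) by (simp add: h_def ij)
    moreover have "int j - int i - 2 = int j' - int i' - 2"
      using pq half[of i j] half[of i' j'] unfolding I_def h_def ij by (metis (mono_tags, lifting) case_prod_conv mem_Collect_eq prod.inject)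
    ultimately show "p = q" by (simp add: ij)
  qed
  have term_eq: "kernel_term 2 z w (h (i, j)) = C * (a \<tau> i * a \<tau> j)" if "even (i + j)" for i j
  proof -
    define n where "n = (int j - int i - 2) div 2"
    have n: "2 * n = int j - int i - 2" using half[OF that] by (simp only: n_def)
    then have rn: "2 * real_of_int n = real j - real i - 2" by linarith
    have "kernel_term 2 z w (h (i, j)) = of_real ((i + 1) * ((j + 1) / 2) / pi\<^sup>2) *
       (((- of_real r) powi int i * (- of_real r) powi n) * (of_real r powi int i * of_real r powi n))"
    proof -
      have co: "real_of_int n + 1 + (real_of_int (int i) + 1) / 2 = (real j + 1) / 2"
        using rn by (simp add: field_simps)
      have "0 < real_of_int n + 1 + (real i + 1) / 2"
        using rn by (simp add: field_simps)
      then have "kernel_term 2 z w (h (i, j)) = of_real ((i + 1) * ((j + 1) / 2) / pi\<^sup>2) *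
          lmono (int i, n) z * cnj (lmono (int i, n) w)"
        unfolding kernel_term_def h_def prod.case n_def[symmetric] co by (simp add: add.commute)
      then show ?thesis
        by (simp add: lmono_def z_def w_def flip: of_real_power_int)
    qed
    also have "((- of_real r) powi int i * (- of_real r) powi n) * (of_real r powi int i * of_real r powi n)
        = \<tau> ^ i * \<tau> ^ j / \<tau>\<^sup>2"
    proof -
      have "((- of_real r) powi int i * (- of_real r) powi n) * (of_real r powi int i * of_real r powi n)
         = (- of_real r * of_real r :: complex) powi (int i + n)"
      proof -
        have "(x powi a * x powi n) * (y powi a * y powi n) = (x * y) powi (a + n)"
          if "x \<noteq> 0" "y \<noteq> 0" for x y :: complex and a
          using that by (simp add: power_int_mult_distrib power_int_add mult_ac)
        from this[of "- of_real r" "of_real r" "int i"] show ?thesis using r by simp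
      qed
      also have "- of_real r * of_real r = \<tau> powi 2"
        by (simp add: \<tau>_def power2_eq_square algebra_simps)
      also have "(\<tau> powi 2) powi (int i + n) = \<tau> powi (int i + int j - 2)"
      proof -
        have "int i + int j - 2 = 2 * (int i + n)" using n by simp
        then show ?thesis by (simp only: power_int_mult)
      qed
      also have "\<dots> = \<tau> ^ i * \<tau> ^ j / \<tau>\<^sup>2"
        using \<tau> by (simp add: power_int_diff power_int_add)
      finally show ?thesis .
    qed
    finally show ?thesis
      by (simp add: C_def a_def)
  qed
  have ha: "(a x has_sum (1 / (1 - x)\<^sup>2)) UNIV" "(\<lambda>n. norm (a x n)) summable_on UNIV" if "norm x < 1" for x
    using has_sum_geometric_deriv[OF that] unfolding a_def by auto
  note p1 = has_sum_product[OF ha(1) ha(1) ha(2) ha(2), OF \<tau>(1) \<tau>(1) \<tau>(1) \<tau>(1), simplified]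
  note p2 = has_sum_product[OF ha(1) ha(1) ha(2) ha(2), OF \<tau>(2) \<tau>(2) \<tau>(2) \<tau>(2), simplified]
  \<comment> \<open>Replacing \<open>\<tau>\<close> by its negative changes the sign of exactly the
    terms with i + j odd, so half the sum of the two products is the sum over
    \<open>I\<close>.\<close>
  have "((\<lambda>p. (C / 2) * ((\<lambda>(i, j). a \<tau> i * a \<tau> j) p + (\<lambda>(i, j). a (- \<tau>) i * a (- \<tau>) j) p)) has_sum
     ((C / 2) * (1 / (1 - \<tau>)\<^sup>2 * (1 / (1 - \<tau>)\<^sup>2) + 1 / (1 + \<tau>)\<^sup>2 * (1 / (1 + \<tau>)\<^sup>2)))) UNIV"
    using p1(1) p2(1) by (intro has_sum_cmult_right has_sum_add) simp_all
  also have "(C / 2) * (1 / (1 - \<tau>)\<^sup>2 * (1 / (1 - \<tau>)\<^sup>2) + 1 / (1 + \<tau>)\<^sup>2 * (1 / (1 + \<tau>)\<^sup>2)) = 0"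
  proof -
    \<comment> \<open>The odd powers cancel and leave 2 (1 + 6 tau^2 + tau^4). Since tau^2 = -r^2,
      this vanishes by the quartic equation for r.\<close>
    have "(1 - \<tau>) ^ 4 + (1 + \<tau>) ^ 4 = 2 * of_real (r ^ 4 - 6 * r\<^sup>2 + 1)"
      unfolding \<tau>_def by (simp add: power4_eq_xxxx power2_eq_square algebra_simps)
    also have "\<dots> = 0" unfolding r4 by simp
    finally have 0: "(1 - \<tau>) ^ 4 + (1 + \<tau>) ^ 4 = 0" .
    have "1 - \<tau> \<noteq> 0" "1 + \<tau> \<noteq> 0" using \<tau> by (auto simp: add_eq_0_iff)
    then have "1 / (1 - \<tau>)\<^sup>2 * (1 / (1 - \<tau>)\<^sup>2) + 1 / (1 + \<tau>)\<^sup>2 * (1 / (1 + \<tau>)\<^sup>2)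
       = ((1 - \<tau>) ^ 4 + (1 + \<tau>) ^ 4) / ((1 - \<tau>) ^ 4 * (1 + \<tau>) ^ 4)"
      by (simp add: add_frac_eq flip: power_add)
    then show ?thesis by (simp add: 0)
  qed
  finally have even_part: "((\<lambda>p. (C / 2) * ((\<lambda>(i, j). a \<tau> i * a \<tau> j) p + (\<lambda>(i, j). a (- \<tau>) i * a (- \<tau>) j) p)) has_sum 0) UNIV" .
  have sign: "a (- \<tau>) i * a (- \<tau>) j = (if even (i + j) then 1 else - 1) * (a \<tau> i * a \<tau> j)" for i j
  proof -
    have "(- \<tau>) ^ i * (- \<tau>) ^ j = (if even (i + j) then 1 else - 1) * (\<tau> ^ i * \<tau> ^ j)"
      unfolding power_add[symmetric] uminus_power_if by (simp add: power_add)
    then show ?thesis by (simp add: a_def mult_ac)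
  qed
  have sum: "((\<lambda>p. kernel_term 2 z w (h p)) has_sum 0) I"
    by (rule has_sum_cong_neutral[THEN iffD2, OF _ _ _ even_part])
       (auto simp: I_def term_eq sign split: if_splits)
  have "(\<lambda>p. norm C * (\<lambda>(i, j). norm (a \<tau> i * a \<tau> j)) p) summable_on I"
    using p1(2) by (intro summable_on_cmult_right) (auto intro: summable_on_subset_banach)
  then have "(\<lambda>p. norm (kernel_term 2 z w (h p))) summable_on I"
    by (rule summable_on_cong[THEN iffD1, rotated]) (auto simp: I_def term_eq norm_mult)
  moreover have "kernel_term 2 z w p = 0" if p: "p \<notin> h ` I" for p
  proof (rule ccontr)
    assume nz: "kernel_term 2 z w p \<noteq> 0"
    obtain m n where mn: "p = (m, n)" by (cases p)
    have "m \<ge> 0" "n + 1 + (real_of_int m + 1) / 2 > 0"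
      using nz by (auto simp: kernel_term_def mn split: if_splits)
    then have "m \<ge> 0" "0 < real_of_int (2 * n + m + 3)" by (simp_all add: field_simps)
    \<comment> \<open>Integrality sharpens 2n + m + 3 > 0 to 2n + m + 2 >= 0, so j is a natural
      number.\<close>
    then have c: "m \<ge> 0" "2 * n + m + 2 \<ge> 0" unfolding of_int_0_less_iff by simp_all
    define i j where "i = nat m" and "j = nat (2 * n + m + 2)"
    have ij: "int i = m" "int j = 2 * n + m + 2" using c by (auto simp: i_def j_def)
    have "even (int i + int j)" unfolding ij by simp
    then have "even (i + j)" by (simp flip: of_nat_add)
    moreover have "h (i, j) = p" by (simp add: h_def mn ij)
    ultimately show False using p by (auto simp: I_def)
  qed
  ultimately have "K z w = 0"
    by (intro kernel_eq_0I[OF _ K zw inj _ _ sum]) auto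
  then show ?thesis using zw by blast
qed

theorem theorem2p8:
  fixes \<gamma> :: real and K :: "complex \<times> complex \<Rightarrow> complex \<times> complex \<Rightarrow> complex"
  assumes "\<gamma> \<ge> 2"
    and "is_bergman_kernel (H_gamma \<gamma>) K"
  shows "\<exists>z\<in>H_gamma \<gamma>. \<exists>w\<in>H_gamma \<gamma>. K z w = 0"
  using assms kernel_zero_gt_2 kernel_zero_eq_2 by (cases "\<gamma> = 2") auto

end
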